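(* Let $A=[A(i,j)]_{i,j=1}^N$ be an irreducible non-permutation matrix with entries in $\{0,1\}$, and let $\varphi_{A^\infty}$ be the ground state on $\mathcal{O}_{A^\infty}$ for the actions $\alpha,\beta,\gamma$ (the unique ground state for $\gamma$). Then: (i) By restriction, $\varphi_{A^\infty}$ gives rise to a ground state $\varphi_{A^\infty}|_{P_N\mathcal{O}_{A^\infty}P_N}$ on $P_N\mathcal{O}_{A^\infty}P_N$ for the (restricted) $\alpha$-, $\beta$- and $\gamma$-actions, respectively. (ii) The ground state on $P_N\mathcal{O}_{A^\infty}P_N$ for the $\gamma$-action is unique. (iii) The ground state $\varphi_{A^\infty}|_{P_N\mathcal{O}_{A^\infty}P_N}$ on $P_N\mathcal{O}_{A^\infty}P_N$ for the $\gamma$-action has spectral gap $1$.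
   Context: $\mathcal{O}_{A^\infty}$ is the universal unital $C^*$-algebra generated by partial isometries $S_i$, $i\in\mathbb{N}$, with $\sum_{j=1}^nS_jS_j^*\le1$ for all $n$; $S_i^*S_i=\sum_{j=1}^NA(i,j)S_jS_j^*+1-\sum_{j=1}^NS_jS_j^*$ for $1\le i\le N$; $S_i^*S_i=1$ for $i>N$. $P_N=1-\sum_{j=1}^NS_jS_j^*$. The actions (of $\mathbb{T}=\mathbb{R}/\mathbb{Z}$, viewed also as one-parameter actions of $\mathbb{R}$) are: $\alpha_t(S_j)=e^{2\pi it}S_j$ for $j\le N$, $\alpha_t(S_j)=S_j$ for $j>N$; $\beta_t(S_j)=S_j$ for $j\le N$, $\beta_t(S_j)=e^{2\pi it}S_j$ for $j>N$; $\gamma_t(S_j)=e^{2\pi it}S_j$ for all $j$. They fix $P_N$ and hence restrict to $P_N\mathcal{O}_{A^\infty}P_N$. (For the transpose $A^t$ in place of $A$ this corner is the reciprocal dual $\widehat{\mathcal{O}}_A$ of the Cuntz–Krieger algebra $\mathcal{O}_A$.) The state $\varphi_{A^\infty}$ on $\mathcal{O}_{A^\infty}$ is determined by $\varphi_{A^\infty}(1)=1$ and $\varphi_{A^\infty}(S_\mu S_\nu^* )=0$ for all finite words $\mu,\nu$ in $\mathbb{N}$ that are not both empty ($S_\mu=S_{\mu_1}\cdots S_{\mu_m}$). Let $\sigma:\mathbb{R}\to\mathrm{Aut}(\mathcal{A})$ be a one-parameter action and $\mathcal{A}_a$ the set of $X\in\mathcal{A}$ for which $t\mapsto\sigma_t(X)$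 extends to an entire function. A state $\varphi$ is a ground state for $\sigma$ if $|\varphi(Y\sigma_z(X))|\le\|X\|\|Y\|$ for all $X\in\mathcal{A}_a$, $Y\in\mathcal{A}$ and all $z$ in the upper half plane $\{t+is\mid s>0\}$. The generator is $\delta_\sigma(X)=\lim_{t\to0}(\sigma_t(X)-X)/t$ with domain $D(\delta_\sigma)$. A ground state has spectral gap $g>0$ if $-i\varphi(X^*\delta_\sigma(X))\ge g\,\varphi(X^*X)$ for all $X\in D(\delta_\sigma)$ with $\varphi(X)=0$. *)

theory Defs
  imports "HOL-Analysis.Analysis" "HOL-Combinatorics.Permutations" "Jordan_Normal_Form.Matrix"
begin

section \<open>Unital C*-algebras\<close>

text \<open>Homogeneity of the norm for complex scalars and isometry of the involution follow from the
C*-identity, so they are not axioms.\<close>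

class cstar_algebra = real_normed_algebra_1 + banach +
  fixes scaleC :: "complex \<Rightarrow> 'a \<Rightarrow> 'a" (infixr \<open>*\<^sub>C\<close> 75)
    and star :: "'a \<Rightarrow> 'a"
  assumes scaleC_add_right: "a *\<^sub>C (x + y) = a *\<^sub>C x + a *\<^sub>C y"
    and scaleC_add_left: "(a + b) *\<^sub>C x = a *\<^sub>C x + b *\<^sub>C x"
    and scaleC_scaleC: "a *\<^sub>C (b *\<^sub>C x) = (a * b) *\<^sub>C x"
    and scaleR_scaleC: "r *\<^sub>R x = complex_of_real r *\<^sub>C x"
    and mult_scaleC_left: "(a *\<^sub>C x) * y = a *\<^sub>C (x * y)"
    and mult_scaleC_right: "x * (a *\<^sub>C y) = a *\<^sub>C (x * y)"
    and star_add: "star (x + y) = star x + star y"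
    and star_scaleC: "star (a *\<^sub>C x) = cnj a *\<^sub>C star x"
    and star_mult: "star (x * y) = star y * star x"
    and star_star: "star (star x) = x"
    and cstar_identity: "norm (star x * x) = (norm x)\<^sup>2"

text \<open>The carrier-based version is needed because the universal property below quantifies over
C*-algebras, and because corners have a unit of their own. The zero algebra is allowed.\<close>

record 'b cstar_struct = "(complex, 'b) module" +
  adj :: "'b \<Rightarrow> 'b"
  nrm :: "'b \<Rightarrow> real"

locale cstar_structure = ring B for B :: "('b, 'm) cstar_struct_scheme" (structure) +
  assumes smult_closed: "x \<in> carrier B \<Longrightarrow> a \<odot> x \<in> carrier B"
    and smult_add_right: "x \<in> carrier B \<Longrightarrow> y \<in> carrier B \<Longrightarrow> a \<odot> (x \<oplus> y) = a \<odot> x \<oplus> a \<odot> y"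
    and smult_add_left: "x \<in> carrier B \<Longrightarrow> (a + b) \<odot> x = a \<odot> x \<oplus> b \<odot> x"
    and smult_smult: "x \<in> carrier B \<Longrightarrow> a \<odot> (b \<odot> x) = (a * b) \<odot> x"
    and smult_1: "x \<in> carrier B \<Longrightarrow> 1 \<odot> x = x"
    and mult_smult_left: "x \<in> carrier B \<Longrightarrow> y \<in> carrier B \<Longrightarrow> (a \<odot> x) \<otimes> y = a \<odot> (x \<otimes> y)"
    and mult_smult_right: "x \<in> carrier B \<Longrightarrow> y \<in> carrier B \<Longrightarrow> x \<otimes> (a \<odot> y) = a \<odot> (x \<otimes> y)"
    and adj_closed: "x \<in> carrier B \<Longrightarrow> adj B x \<in> carrier B"
    and adj_add: "x \<in> carrier B \<Longrightarrow> y \<in> carrier B \<Longrightarrow> adj B (x \<oplus> y) = adj B x \<oplus> adj B y"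
    and adj_smult: "x \<in> carrier B \<Longrightarrow> adj B (a \<odot> x) = cnj a \<odot> adj B x"
    and adj_mult: "x \<in> carrier B \<Longrightarrow> y \<in> carrier B \<Longrightarrow> adj B (x \<otimes> y) = adj B y \<otimes> adj B x"
    and adj_adj: "x \<in> carrier B \<Longrightarrow> adj B (adj B x) = x"
    and nrm_nonneg: "x \<in> carrier B \<Longrightarrow> 0 \<le> nrm B x"
    and nrm_eq_0: "x \<in> carrier B \<Longrightarrow> nrm B x = 0 \<longleftrightarrow> x = \<zero>"
    and nrm_triangle: "x \<in> carrier B \<Longrightarrow> y \<in> carrier B \<Longrightarrow> nrm B (x \<oplus> y) \<le> nrm B x + nrm B y"
    and nrm_smult: "x \<in> carrier B \<Longrightarrow> nrm B (a \<odot> x) = cmod a * nrm B x"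
    and nrm_mult: "x \<in> carrier B \<Longrightarrow> y \<in> carrier B \<Longrightarrow> nrm B (x \<otimes> y) \<le> nrm B x * nrm B y"
    and nrm_cstar: "x \<in> carrier B \<Longrightarrow> nrm B (adj B x \<otimes> x) = (nrm B x)\<^sup>2"
    and nrm_complete: "(\<forall>n. f n \<in> carrier B) \<Longrightarrow>
      (\<forall>e>0. \<exists>M. \<forall>m\<ge>M. \<forall>n\<ge>M. nrm B (f m \<ominus> f n) < e) \<Longrightarrow>
      \<exists>l\<in>carrier B. (\<lambda>n. nrm B (f n \<ominus> l)) \<longlonglongrightarrow> 0"

definition star_hom :: "('b, 'm) cstar_struct_scheme \<Rightarrow> ('c, 'n) cstar_struct_scheme \<Rightarrow> ('b \<Rightarrow> 'c) set"
  where "star_hom B C = {h \<in> ring_hom B C.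
    \<forall>x\<in>carrier B. (\<forall>a. h (a \<odot>\<^bsub>B\<^esub> x) = a \<odot>\<^bsub>C\<^esub> h x) \<and> h (adj B x) = adj C (h x)}"

definition cstar_on :: "'a::cstar_algebra set \<Rightarrow> 'a \<Rightarrow> 'a cstar_struct"
  where "cstar_on B e = \<lparr>carrier = B, mult = (*), one = e, zero = 0, add = (+),
    smult = scaleC, adj = star, nrm = norm\<rparr>"

lemma cstar_on_simps [simp]:
  "carrier (cstar_on B e) = B" "mult (cstar_on B e) = (*)" "one (cstar_on B e) = e"
  "zero (cstar_on B e) = 0" "add (cstar_on B e) = (+)" "smult (cstar_on B e) = scaleC"
  "adj (cstar_on B e) = star" "nrm (cstar_on B e) = norm"
  by (simp_all add: cstar_on_def)

definition corner :: "'a::cstar_algebra \<Rightarrow> 'a set"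
  where "corner p = {p * x * p | x. True}"

lemma scaleC_one: "1 *\<^sub>C (x::'a::cstar_algebra) = x"
  using scaleR_scaleC[of 1 x] by simp

lemma scaleC_minus_one: "(-1) *\<^sub>C (x::'a::cstar_algebra) = - x"
  using scaleR_scaleC[of "-1" x] by simp

lemma norm_star: "norm (star (x::'a::cstar_algebra)) = norm x"
proof -
  have le: "norm y \<le> norm (star y)" for y :: 'a
  proof (cases "y = 0")
    case False
    have "norm y * norm y \<le> norm (star y) * norm y"
      using norm_mult_ineq[of "star y" y] cstar_identity[of y] by (simp add: power2_eq_square)
    then show ?thesis using False by (simp add: mult_le_cancel_right)
  qed simp
  show ?thesis using le[of x] le[of "star x"] by (simp add: star_star)
qed

lemma norm_scaleC: "norm (a *\<^sub>C (x::'a::cstar_algebra)) = cmod a * norm x"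
proof -
  have "star (a *\<^sub>C x) * (a *\<^sub>C x) = (cmod a)\<^sup>2 *\<^sub>R (star x * x)"
    by (simp add: star_scaleC mult_scaleC_left mult_scaleC_right scaleC_scaleC scaleR_scaleC
        complex_norm_square del: of_real_power)
  then have "(norm (a *\<^sub>C x))\<^sup>2 = (cmod a * norm x)\<^sup>2"
    using cstar_identity[of "a *\<^sub>C x"] cstar_identity[of x] by (simp add: power_mult_distrib)
  then show ?thesis by simp
qed

lemma cstar_on_a_minus:
  assumes "abelian_group (cstar_on B e)" "y \<in> B" "- y \<in> B"
  shows "x \<ominus>\<^bsub>cstar_on B e\<^esub> y = x - y"
proof -
  interpret abelian_group "cstar_on B e" by fact
  have "\<ominus>\<^bsub>cstar_on B e\<^esub> y = - y"
    by (rule minus_equality) (simp_all add: assms)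
  then show ?thesis by (simp add: a_minus_def)
qed

lemma cstar_structure_cstar_on:
  fixes e :: "'a::cstar_algebra"
  assumes cl: "closed B" and e: "e \<in> B" "\<And>x. x \<in> B \<Longrightarrow> e * x = x \<and> x * e = x"
    and add: "\<And>x y. x \<in> B \<Longrightarrow> y \<in> B \<Longrightarrow> x + y \<in> B"
    and mult: "\<And>x y. x \<in> B \<Longrightarrow> y \<in> B \<Longrightarrow> x * y \<in> B"
    and scale: "\<And>a x. x \<in> B \<Longrightarrow> a *\<^sub>C x \<in> B"
    and st: "\<And>x. x \<in> B \<Longrightarrow> star x \<in> B"
  shows "cstar_structure (cstar_on B e)"
proof -
  have neg: "- x \<in> B" if "x \<in> B" for x
    using scale[OF that, of "-1"] by (simp add: scaleC_minus_one)
  have zero: "0 \<in> B" using add[OF e(1) neg[OF e(1)]] by simp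
  have ring: "ring (cstar_on B e)"
  proof (rule ringI)
    show "abelian_group (cstar_on B e)"
      by (rule abelian_groupI) (use add zero in \<open>auto simp: add_ac intro: bexI[OF _ neg]\<close>)
    show "monoid (cstar_on B e)"
      by (rule monoidI) (use mult e in \<open>auto simp: mult.assoc\<close>)
  qed (simp_all add: distrib_left distrib_right)
  have min: "x \<ominus>\<^bsub>cstar_on B e\<^esub> y = x - y" if "x \<in> B" "y \<in> B" for x y
    using cstar_on_a_minus[OF ring.is_abelian_group[OF ring] that(2) neg[OF that(2)]] .
  have compl: "\<exists>l\<in>B. (\<lambda>n. norm (f n \<ominus>\<^bsub>cstar_on B e\<^esub> l)) \<longlonglongrightarrow> 0"
    if f: "\<forall>n. f n \<in> B"
      and C: "\<forall>e'>0. \<exists>M. \<forall>m\<ge>M. \<forall>n\<ge>M. norm (f m \<ominus>\<^bsub>cstar_on B e\<^esub> f n) < e'" for f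
  proof -
    have "Cauchy f" using C f by (auto simp: min Cauchy_def dist_norm)
    then obtain l where l: "f \<longlonglongrightarrow> l" using Cauchy_convergent convergent_def by blast
    then have "l \<in> B" using cl f closed_sequentially by blast
    moreover have "(\<lambda>n. norm (f n - l)) \<longlonglongrightarrow> 0"
      using l by (simp add: LIM_zero_iff tendsto_norm_zero_iff)
    ultimately show ?thesis using f by (auto simp: min)
  qed
  interpret ring "cstar_on B e" by fact
  show ?thesis
    apply unfold_locales
    using compl
    by (auto simp: scale st scaleC_add_right scaleC_add_left scaleC_scaleC scaleC_one
        mult_scaleC_left mult_scaleC_right star_add star_scaleC star_mult star_star
        norm_triangle_ineq norm_scaleC norm_mult_ineq cstar_identity)
qed

lemma cstar_structure_UNIV: "cstar_structure (cstar_on (UNIV :: 'a::cstar_algebra set) 1)"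
  by (rule cstar_structure_cstar_on) auto

lemma cstar_structure_corner:
  fixes p :: "'a::cstar_algebra"
  assumes p: "p * p = p" "star p = p"
  shows "cstar_structure (cstar_on (corner p) p)"
proof -
  have eq: "corner p = {x. p * x * p = x}"
  proof -
    have "p * (p * x * p) * p = p * x * p" for x
      by (simp add: mult.assoc p(1)) (simp flip: mult.assoc add: p(1))
    then show ?thesis unfolding corner_def by (smt (verit) Collect_cong)
  qed
  have l: "p * x = x" if "x \<in> corner p" for x
    using that unfolding corner_def by (clarsimp simp flip: mult.assoc simp: p(1))
  have r: "x * p = x" if "x \<in> corner p" for x
    using that unfolding corner_def by (clarsimp simp: mult.assoc p(1))
  show ?thesis
  proof (rule cstar_structure_cstar_on)
    show "closed (corner p)" unfolding eq
      by (intro closed_Collect_eq continuous_intros)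
    show "x + y \<in> corner p" if "x \<in> corner p" "y \<in> corner p" for x y
      using that by (simp add: eq algebra_simps)
    show "a *\<^sub>C x \<in> corner p" if "x \<in> corner p" for x a
      using that by (simp add: eq mult_scaleC_left mult_scaleC_right)
    show "star x \<in> corner p" if "x \<in> corner p" for x
    proof -
      have "star (p * x * p) = star x" using that by (simp add: eq)
      then show ?thesis by (simp add: eq star_mult p mult.assoc)
    qed
    show "x * y \<in> corner p" if "x \<in> corner p" "y \<in> corner p" for x y
      using l[OF that(1)] r[OF that(2)] unfolding eq by (simp add: mult.assoc) (simp flip: mult.assoc)
    show "p \<in> corner p" by (simp add: eq p)
  qed (use l r in auto)
qed


section \<open>The matrix and the universal algebra\<close>

definition irreducible_matrix :: "nat \<Rightarrow> nat mat \<Rightarrow> bool"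
  where "irreducible_matrix N A \<longleftrightarrow>
    A \<in> carrier_mat N N \<and> (\<forall>i<N. \<forall>j<N. \<exists>m>0. (A ^\<^sub>m m) $$ (i, j) > 0)"

definition permutation_matrix :: "nat \<Rightarrow> nat mat \<Rightarrow> bool"
  where "permutation_matrix N A \<longleftrightarrow> A \<in> carrier_mat N N \<and>
    (\<exists>p. p permutes {..<N} \<and> (\<forall>i<N. \<forall>j<N. A $$ (i, j) = (if j = p i then 1 else 0)))"

text \<open>All indices are shifted down by one: the generators are numbered from 0, and the first
\<open>N\<close> of them (those that see the matrix) are those with \<open>i < N\<close>. An element is positive in a
C*-algebra iff it has the form \<open>z\<^sup>* z\<close>.\<close>

definition OA_inf_relations :: "('b, 'm) cstar_struct_scheme \<Rightarrow> nat \<Rightarrow> nat mat \<Rightarrow> (nat \<Rightarrow> 'b) \<Rightarrow> bool"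
  where "OA_inf_relations B N A T \<longleftrightarrow>
    (\<forall>i. T i \<in> carrier B) \<and>
    (\<forall>i. T i \<otimes>\<^bsub>B\<^esub> adj B (T i) \<otimes>\<^bsub>B\<^esub> T i = T i) \<and>
    (\<forall>n. \<exists>z\<in>carrier B.
      \<one>\<^bsub>B\<^esub> \<ominus>\<^bsub>B\<^esub> (\<Oplus>\<^bsub>B\<^esub>j\<in>{..<n}. T j \<otimes>\<^bsub>B\<^esub> adj B (T j)) = adj B z \<otimes>\<^bsub>B\<^esub> z) \<and>
    (\<forall>i<N. adj B (T i) \<otimes>\<^bsub>B\<^esub> T i =
      (\<Oplus>\<^bsub>B\<^esub>j\<in>{..<N}. of_nat (A $$ (i, j)) \<odot>\<^bsub>B\<^esub> (T j \<otimes>\<^bsub>B\<^esub> adj B (T j)))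
      \<oplus>\<^bsub>B\<^esub> (\<one>\<^bsub>B\<^esub> \<ominus>\<^bsub>B\<^esub> (\<Oplus>\<^bsub>B\<^esub>j\<in>{..<N}. T j \<otimes>\<^bsub>B\<^esub> adj B (T j)))) \<and>
    (\<forall>i\<ge>N. adj B (T i) \<otimes>\<^bsub>B\<^esub> T i = \<one>\<^bsub>B\<^esub>)"

lemma finsum_cstar_on_UNIV:
  fixes f :: "'i \<Rightarrow> 'a::cstar_algebra"
  shows "finsum (cstar_on UNIV 1) f I = sum f I"
proof -
  interpret cstar_structure "cstar_on (UNIV :: 'a set) 1" by (rule cstar_structure_UNIV)
  show ?thesis
    by (induction I rule: infinite_finite_induct) (simp_all add: finsum_infinite finsum_insert)
qed

lemma OA_inf_relations_UNIV:
  fixes S :: "nat \<Rightarrow> 'a::cstar_algebra"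
  shows "OA_inf_relations (cstar_on UNIV 1) N A S \<longleftrightarrow>
    (\<forall>i. S i * star (S i) * S i = S i) \<and>
    (\<forall>n. \<exists>z. 1 - (\<Sum>j<n. S j * star (S j)) = star z * z) \<and>
    (\<forall>i<N. star (S i) * S i = (\<Sum>j<N. of_nat (A $$ (i, j)) *\<^sub>C (S j * star (S j)))
      + (1 - (\<Sum>j<N. S j * star (S j)))) \<and>
    (\<forall>i\<ge>N. star (S i) * S i = 1)"
proof -
  interpret cstar_structure "cstar_on (UNIV :: 'a set) 1" by (rule cstar_structure_UNIV)
  have [simp]: "x \<ominus>\<^bsub>cstar_on UNIV 1\<^esub> y = x - y" for x y :: 'a
    by (rule cstar_on_a_minus) (auto intro: abelian_group_axioms)
  show ?thesis by (simp add: OA_inf_relations_def finsum_cstar_on_UNIV)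
qed

inductive_set star_alg_gen :: "(nat \<Rightarrow> 'a::cstar_algebra) \<Rightarrow> 'a set" for S
  where
    one: "1 \<in> star_alg_gen S"
  | gen: "S i \<in> star_alg_gen S"
  | add: "x \<in> star_alg_gen S \<Longrightarrow> y \<in> star_alg_gen S \<Longrightarrow> x + y \<in> star_alg_gen S"
  | mult: "x \<in> star_alg_gen S \<Longrightarrow> y \<in> star_alg_gen S \<Longrightarrow> x * y \<in> star_alg_gen S"
  | scale: "x \<in> star_alg_gen S \<Longrightarrow> a *\<^sub>C x \<in> star_alg_gen S"
  | star: "x \<in> star_alg_gen S \<Longrightarrow> star x \<in> star_alg_gen S"

text \<open>The type \<open>'a\<close>, with generators \<open>S\<close>, is the universal unital C*-algebra of the relations.
Letting the test algebras \<open>B\<close> have their carrier inside \<open>'a\<close> is no restriction: the C*-subalgebra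
generated by a sequence is separable, hence has at most the cardinality of the continuum, and so
does not exceed the cardinality of \<open>'a\<close>, a nonzero complex vector space. Uniqueness of \<open>h\<close> follows
since *-homomorphisms are continuous and \<open>S\<close> generates.\<close>

definition is_OA_inf :: "nat \<Rightarrow> nat mat \<Rightarrow> (nat \<Rightarrow> 'a::cstar_algebra) \<Rightarrow> bool"
  where "is_OA_inf N A S \<longleftrightarrow>
    OA_inf_relations (cstar_on UNIV 1) N A S \<and>
    closure (star_alg_gen S) = UNIV \<and>
    (\<forall>(B :: 'a cstar_struct) T. cstar_structure B \<and> OA_inf_relations B N A T \<longrightarrow>
      (\<exists>h \<in> star_hom (cstar_on UNIV 1) B. \<forall>i. h (S i) = T i))"

definition P_proj :: "nat \<Rightarrow> (nat \<Rightarrow> 'a::cstar_algebra) \<Rightarrow> 'a"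
  where "P_proj N S = 1 - (\<Sum>j<N. S j * star (S j))"

definition word_prod :: "(nat \<Rightarrow> 'a::cstar_algebra) \<Rightarrow> nat list \<Rightarrow> 'a"
  where "word_prod S \<mu> = prod_list (map S \<mu>)"


section \<open>Dynamics\<close>

text \<open>Throughout, \<open>B\<close> is (the carrier of) a C*-subalgebra of \<open>'a\<close> with its own unit \<open>e\<close>; functionals
and actions on \<open>B\<close> are functions on \<open>'a\<close> of which only the values on \<open>B\<close> matter.\<close>

definition one_parameter_action :: "'a::cstar_algebra set \<Rightarrow> 'a \<Rightarrow> (real \<Rightarrow> 'a \<Rightarrow> 'a) \<Rightarrow> bool"
  where "one_parameter_action B e \<sigma> \<longleftrightarrow>
    (\<forall>t. \<sigma> t \<in> star_hom (cstar_on B e) (cstar_on B e) \<and> bij_betw (\<sigma> t) B B) \<and>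
    (\<forall>x\<in>B. \<sigma> 0 x = x) \<and>
    (\<forall>s t. \<forall>x\<in>B. \<sigma> (s + t) x = \<sigma> s (\<sigma> t x)) \<and>
    (\<forall>x\<in>B. continuous_on UNIV (\<lambda>t. \<sigma> t x))"

definition state :: "'a::cstar_algebra set \<Rightarrow> 'a \<Rightarrow> ('a \<Rightarrow> complex) \<Rightarrow> bool"
  where "state B e \<phi> \<longleftrightarrow>
    (\<forall>x\<in>B. \<forall>y\<in>B. \<phi> (x + y) = \<phi> x + \<phi> y) \<and>
    (\<forall>a. \<forall>x\<in>B. \<phi> (a *\<^sub>C x) = a * \<phi> x) \<and>
    (\<forall>x\<in>B. Im (\<phi> (star x * x)) = 0 \<and> 0 \<le> Re (\<phi> (star x * x))) \<and>
    \<phi> e = 1"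

text \<open>\<open>F\<close> is the (necessarily unique) entire extension \<open>z \<mapsto> \<sigma>\<^sub>z(X)\<close> of the orbit of \<open>X\<close>, complex
differentiable in norm; \<open>X\<close> is an analytic element iff such an \<open>F\<close> exists.\<close>

definition entire_orbit ::
    "'a::cstar_algebra set \<Rightarrow> (real \<Rightarrow> 'a \<Rightarrow> 'a) \<Rightarrow> 'a \<Rightarrow> (complex \<Rightarrow> 'a) \<Rightarrow> bool"
  where "entire_orbit B \<sigma> X F \<longleftrightarrow>
    (\<forall>t. F (complex_of_real t) = \<sigma> t X) \<and>
    (\<forall>z. F z \<in> B) \<and>
    (\<forall>z. \<exists>D. (F has_derivative (\<lambda>h. h *\<^sub>C D)) (at z))"

definition ground_state ::
    "'a::cstar_algebra set \<Rightarrow> 'a \<Rightarrow> (real \<Rightarrow> 'a \<Rightarrow> 'a) \<Rightarrow> ('a \<Rightarrow> complex) \<Rightarrow> bool"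
  where "ground_state B e \<sigma> \<phi> \<longleftrightarrow>
    one_parameter_action B e \<sigma> \<and> state B e \<phi> \<and>
    (\<forall>X\<in>B. \<forall>F. entire_orbit B \<sigma> X F \<longrightarrow>
      (\<forall>Y\<in>B. \<forall>z. Im z > 0 \<longrightarrow> cmod (\<phi> (Y * F z)) \<le> norm X * norm Y))"

text \<open>\<open>X\<close> is in the domain of the generator of \<open>\<sigma>\<close>, with image \<open>D\<close>.\<close>

definition has_generator :: "(real \<Rightarrow> 'a::cstar_algebra \<Rightarrow> 'a) \<Rightarrow> 'a \<Rightarrow> 'a \<Rightarrow> bool"
  where "has_generator \<sigma> X D \<longleftrightarrow> ((\<lambda>t. (1 / t) *\<^sub>R (\<sigma> t X - X)) \<longlongrightarrow> D) (at 0)"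

text \<open>The inequality between complex numbers is spelled out on real and imaginary parts.\<close>

definition spectral_gap ::
    "'a::cstar_algebra set \<Rightarrow> 'a \<Rightarrow> (real \<Rightarrow> 'a \<Rightarrow> 'a) \<Rightarrow> ('a \<Rightarrow> complex) \<Rightarrow> real \<Rightarrow> bool"
  where "spectral_gap B e \<sigma> \<phi> g \<longleftrightarrow>
    ground_state B e \<sigma> \<phi> \<and> g > 0 \<and>
    (\<forall>X\<in>B. \<forall>D\<in>B. has_generator \<sigma> X D \<and> \<phi> X = 0 \<longrightarrow>
      Im (- \<i> * \<phi> (star X * D)) = 0 \<and>
      Re (- \<i> * \<phi> (star X * D)) \<ge> g * Re (\<phi> (star X * X)))"

definition phase :: "real \<Rightarrow> complex"
  where "phase t = exp (2 * of_real pi * \<i> * of_real t)"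

end

theory Submission
  imports Defs "HOL-Complex_Analysis.Complex_Analysis"
begin

text \<open>Words \<open>S\<^sub>\<mu> S\<^sub>\<nu>\<^sup>*\<close> span a dense *-subalgebra, and \<open>\<phi> (Y S\<^sub>\<mu> S\<^sub>\<nu>\<^sup>*) = 0\<close> for nonempty \<open>\<nu>\<close>. Hence
\<open>t \<mapsto> \<phi> (Y \<sigma>\<^sub>t(X))\<close> is a uniform limit of polynomials in \<open>exp (2 \<pi> i t)\<close>. By the maximum
principle it extends to the upper half plane with the same bound, which is the ground state
property. For \<open>\<gamma>\<close> and \<open>\<phi> X = 0\<close> the constant term vanishes as well, so the extension of
\<open>\<phi> (X\<^sup>* \<gamma>\<^sub>t(X))\<close> decays like \<open>exp (- 2 \<pi> Im t)\<close>; its derivative at \<open>0\<close> gives the gap, in fact \<open>2 \<pi>\<close>.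

A ground state \<open>\<psi>\<close> for \<open>\<gamma>\<close> on the corner satisfies \<open>\<psi> (Y X) = 0\<close> for \<open>X\<close> of negative degree. With
the isometry \<open>V = S\<^sub>N\<close>, which satisfies \<open>P V = V\<close>, the words with \<open>|\<nu>| \<ge> 2\<close> are of this kind since
\<open>S\<^sub>\<mu> S\<^sub>\<nu>\<^sup>* = (S\<^sub>\<mu> V\<^sup>*) (V S\<^sub>\<nu>\<^sup>*)\<close>. This determines \<open>\<psi>\<close>.\<close>

section \<open>Positivity in C*-algebras\<close>

text \<open>The relations only say that \<open>1 - (\<Sum>j<n. S j * star (S j))\<close> has the
  form \<open>star z * z\<close>. Words multiply to combinations of words only once
  \<open>star (S i) * S j = 0\<close> for distinct \<open>i\<close>, \<open>j\<close> has been
  extracted from this. That is a fact about the order of a C*-algebra: positive elements must form a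
  proper cone, and \<open>star z * z\<close> must never be negative unless it is 0. Norm bounds on
  powers take the place of the spectrum in proving it. For uniqueness the obstacle is that
  \<open>star (W \<nu>)\<close> need not lie in the corner, so the negative-degree argument does not
  reach it. A factor \<open>V\<close> on its left brings it into the corner but costs one degree,
  hence the threshold 2. Single letters are handled by inserting
  \<open>1 = P + (\<Sum>k<N. S k * star (S k))\<close> between them: the second part lengthens the
  words to 2, and the first keeps both factors in the corner. The constant \<open>2 * pi\<close> is
  the lowest positive frequency of an action of period one.\<close>

lemma scaleC_zero_left [simp]: "0 *\<^sub>C (x::'a::cstar_algebra) = 0"
  using scaleC_add_left[of 0 0 x] by simp

lemma scaleC_zero_right [simp]: "a *\<^sub>C (0::'a::cstar_algebra) = 0"
  using scaleC_add_right[of a "0::'a" 0] by simp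

lemma scaleC_minus_left: "(- a) *\<^sub>C (x::'a::cstar_algebra) = - (a *\<^sub>C x)"
  using scaleC_scaleC[of "-1" a x] by (simp add: scaleC_minus_one)

lemma scaleC_minus_right: "a *\<^sub>C (- x::'a::cstar_algebra) = - (a *\<^sub>C x)"
  by (metis scaleC_scaleC scaleC_minus_one mult.commute)

lemma scaleC_diff_right: "a *\<^sub>C (x - y::'a::cstar_algebra) = a *\<^sub>C x - a *\<^sub>C y"
  using scaleC_add_right[of a x "- y"] by (simp add: scaleC_minus_right)

lemma star_scaleR: "star (r *\<^sub>R x) = r *\<^sub>R star (x::'a::cstar_algebra)"
  by (simp add: scaleR_scaleC star_scaleC)

lemma bounded_linear_star: "bounded_linear (star :: 'a::cstar_algebra \<Rightarrow> 'a)"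
  by (rule bounded_linear_intro[where K = 1]) (simp_all add: star_add star_scaleR norm_star)

lemmas star_diff = linear_diff[OF bounded_linear.linear[OF bounded_linear_star]]
lemmas star_zero = linear_0[OF bounded_linear.linear[OF bounded_linear_star]]
lemmas star_sum = linear_sum[OF bounded_linear.linear[OF bounded_linear_star]]

lemma star_one [simp]: "star (1::'a::cstar_algebra) = 1"
proof -
  have "star (star (1::'a) * 1) = star (star 1) * 1" by (simp add: star_star)
  then show ?thesis by (metis mult_1_left mult.right_neutral star_mult star_star)
qed

lemma star_mult_self_eq_0_iff: "star x * x = 0 \<longleftrightarrow> x = (0::'a::cstar_algebra)"
  by (metis cstar_identity mult_zero_right norm_eq_zero power2_eq_square mult_eq_0_iff)

lemma star_power: "star (x ^ n) = star (x::'a::cstar_algebra) ^ n"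
  by (induction n) (simp_all add: star_mult power_commutes)

lemma selfadjoint_square_eq_0: "star x = x \<Longrightarrow> x * x = 0 \<Longrightarrow> x = (0::'a::cstar_algebra)"
  using star_mult_self_eq_0_iff[of x] by simp

lemma norm_power_2_power:
  assumes "star x = (x::'a::cstar_algebra)"
  shows "norm (x ^ (2 ^ n)) = norm x ^ (2 ^ n)"
proof (induction n)
  case (Suc n)
  have "norm (x ^ (2 ^ Suc n)) = norm (star (x ^ (2 ^ n)) * x ^ (2 ^ n))"
    by (simp add: star_power assms power_mult power2_eq_square mult.commute[of 2])
  also have "\<dots> = (norm x ^ (2 ^ n))\<^sup>2"
    by (simp only: cstar_identity Suc)
  finally show ?case by (simp add: power_mult mult.commute[of 2])
qed simp

text \<open>For self-adjoint elements the C*-identity gives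
  \<open>norm (x ^ (2 ^ n)) = norm x ^ (2 ^ n)\<close>, so large powers wash out the constant
  \<open>C\<close>. This is the form of the spectral radius formula used below.\<close>

lemma norm_le_of_power_bound:
  assumes x: "star x = (x::'a::cstar_algebra)" and t: "0 \<le> t"
    and b: "\<And>n. norm (x ^ n) \<le> C * t ^ n"
  shows "norm x \<le> t"
proof (rule ccontr)
  assume "\<not> norm x \<le> t"
  then have nt: "norm x > t" by simp
  show False
  proof (cases "t = 0")
    case True
    then show ?thesis using b[of 1] nt by simp
  next
    case False
    with t have tp: "t > 0" by simp
    define r where "r = norm x / t"
    have r: "r > 1" using nt tp by (simp add: r_def)
    obtain n where n: "C < r ^ n" using real_arch_pow[OF r] by blast
    have "r ^ n \<le> r ^ (2 ^ n)" using r by (intro power_increasing) (auto simp: less_imp_le)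
    moreover have "r ^ (2 ^ n) \<le> C"
      using b[of "2 ^ n"] tp by (simp add: norm_power_2_power[OF x] r_def power_divide field_simps)
    ultimately show False using n by linarith
  qed
qed

lemma selfadjoint_sqrt:
  fixes k u :: "'a::cstar_algebra"
  assumes k: "star k = k" "norm k < 1" and ku: "k * u = u * k"
  obtains w where "star w = w" "w * w = 1 - k" "w * u = u * w"
proof -
  \<comment> \<open>The square root is \<open>1 - y\<close> for the fixed point \<open>y\<close> of \<open>y \<mapsto> (k + y\<^sup>2) / 2\<close>, a contraction
      of the ball of radius \<open>r < 1\<close> where \<open>\<parallel>k\<parallel> + r\<^sup>2 = 2 r\<close>.\<close>
  define r where "r = 1 - sqrt (1 - norm k)"
  have r: "0 \<le> r" "r < 1" using k(2) by (auto simp: r_def)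
  have "(1 - r)\<^sup>2 = 1 - norm k" using k(2) by (simp add: r_def)
  then have kr: "norm k + r\<^sup>2 = 2 * r" by (simp add: power2_eq_square algebra_simps)
  \<comment> \<open>All three conditions are closed and preserved by \<open>f\<close>, so the fixed
    point inherits self-adjointness and commutation with \<open>u\<close>.\<close>
  define B where "B = {y. star y = y \<and> y * u = u * y \<and> norm y \<le> r}"
  define f where "f y = (1/2) *\<^sub>R (k + y * y)" for y
  have cont: "continuous_on UNIV (star :: 'a \<Rightarrow> 'a)"
    using bounded_linear_star by (rule bounded_linear.continuous_on) (rule continuous_on_id)
  have "closed B" unfolding B_def
    by (intro closed_Collect_conj closed_Collect_eq closed_Collect_le continuous_intros cont)
  then have "complete B" by (simp add: complete_eq_closed)
  moreover have "0 \<in> B" using r by (simp add: B_def star_zero)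
  moreover have "f ` B \<subseteq> B"
  proof
    fix v assume "v \<in> f ` B"
    then obtain y where y: "star y = y" "y * u = u * y" "norm y \<le> r" and v: "v = f y"
      by (auto simp: B_def)
    have "norm (y * y) \<le> r\<^sup>2"
      using mult_mono[OF y(3) y(3)] r norm_mult_ineq[of y y] by (simp add: power2_eq_square)
    then have "norm (k + y * y) \<le> 2 * r" using kr norm_triangle_ineq[of k "y * y"] by linarith
    then have "norm (f y) \<le> r" by (simp add: f_def)
    moreover have "f y * u = u * f y"
      unfolding f_def using y(2) ku by (simp add: distrib_left distrib_right) (metis mult.assoc)
    moreover have "star (f y) = f y" by (simp add: f_def star_scaleR star_add star_mult y k)
    ultimately show "v \<in> B" by (simp add: B_def v)
  qed
  moreover have "dist (f x) (f y) \<le> r * dist x y" if "x \<in> B" "y \<in> B" for x y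
  proof -
    have "f x - f y = (1/2) *\<^sub>R (x * (x - y) + (x - y) * y)"
      by (simp add: f_def algebra_simps)
    then have "2 * norm (f x - f y) = norm (x * (x - y) + (x - y) * y)" by simp
    also have "\<dots> \<le> norm x * norm (x - y) + norm (x - y) * norm y"
      by (intro norm_triangle_le add_mono norm_mult_ineq)
    also have "\<dots> \<le> r * norm (x - y) + norm (x - y) * r"
      using that by (intro add_mono mult_right_mono mult_left_mono) (auto simp: B_def)
    finally show ?thesis by (simp add: dist_norm)
  qed
  ultimately obtain y where y: "y \<in> B" "f y = y"
    using Banach_fix[of B r f] r by blast
  have "k + y * y = y + y"
  proof -
    have "2 *\<^sub>R f y = k + y * y" by (simp add: f_def)
    then show ?thesis using y(2) by (simp add: scaleR_2)
  qed
  then have "(1 - y) * (1 - y) = 1 - k" by (simp add: algebra_simps)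
  then show thesis
    using y(1) by (intro that[of "1 - y"]) (auto simp: B_def star_diff algebra_simps)
qed

text \<open>The element \<open>u + \<i> *\<^sub>C w\<close> has norm 1 by the C*-identity, and
  \<open>u\<close> is the mean of it and its adjoint. The hypotheses are symmetric in
  \<open>u\<close> and \<open>w\<close>.\<close>

lemma norm_le_1_of_unit_circle:
  fixes u w :: "'a::cstar_algebra"
  assumes u: "star u = u" and w: "star w = w" and uw: "w * u = u * w" and eq: "u * u + w * w = 1"
  shows "norm u \<le> 1" "norm w \<le> 1"
proof -
  have *: "norm v \<le> 1" if v: "star v = v" "star x = x" "x * v = v * x" "v * v + x * x = 1"
    for v x :: 'a
  proof -
    define a where "a = v + \<i> *\<^sub>C x"
    have sa: "star a = v - \<i> *\<^sub>C x" by (simp add: a_def star_add star_scaleC v scaleC_minus_left)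
    have "star a * a = v * v + x * x"
      unfolding sa by (simp add: a_def algebra_simps mult_scaleC_left mult_scaleC_right scaleC_scaleC
          scaleC_diff_right v(3) scaleC_minus_one)
    then have "star a * a = 1" using v(4) by simp
    then have "norm a = 1" using cstar_identity[of a] by (simp add: power2_eq_1_iff) (metis norm_ge_zero not_one_le_zero neg_0_le_iff_le order_trans)
    moreover have "2 *\<^sub>R v = a + star a" unfolding sa by (simp add: a_def scaleR_2)
    then have "2 * norm v \<le> norm a + norm (star a)"
      by (metis norm_triangle_ineq norm_scaleR abs_numeral)
    ultimately show ?thesis by (simp add: norm_star)
  qed
  show "norm u \<le> 1" "norm w \<le> 1"
    using *[of u w] *[of w u] assms by (simp_all add: add.commute)
qed

text \<open>An ad-hoc form of positivity: the spectrum of \<open>h\<close> lies in \<open>[0, 2 t]\<close>. It makes the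
positive elements a cone without any functional calculus.\<close>

definition positive :: "'a::cstar_algebra \<Rightarrow> bool"
  where "positive h \<longleftrightarrow> star h = h \<and> (\<exists>t\<ge>0. norm (t *\<^sub>R 1 - h) \<le> t)"

lemma positive_add: 
  assumes "positive g" "positive h" shows "positive (g + h)"
proof -
  obtain s t where st: "0 \<le> s" "norm (s *\<^sub>R 1 - g) \<le> s" "0 \<le> t" "norm (t *\<^sub>R 1 - h) \<le> t"
    using assms by (auto simp: positive_def)
  have "norm ((s + t) *\<^sub>R 1 - (g + h)) \<le> s + t"
  proof -
    have "(s + t) *\<^sub>R 1 - (g + h) = (s *\<^sub>R 1 - g) + (t *\<^sub>R 1 - h)" by (simp add: algebra_simps)
    then show ?thesis by (simp only:) (intro norm_triangle_le add_mono st)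
  qed
  then show ?thesis using assms st unfolding positive_def
    by (auto simp: star_add intro!: exI[of _ "s + t"])
qed

lemma positive_0 [simp]: "positive 0"
  by (auto simp: positive_def star_zero intro: exI[of _ 0])

lemma positive_sum: "(\<And>i. i \<in> I \<Longrightarrow> positive (f i)) \<Longrightarrow> positive (sum f I)"
  by (induction I rule: infinite_finite_induct) (auto intro: positive_add)

text \<open>After scaling to norm below 1, \<open>1 - v * v\<close> has a root \<open>w\<close>
  commuting with \<open>v\<close>, and the pair lies on the unit circle. So
  \<open>norm (1 - v * v) \<le> 1\<close>, which is the defining bound with
  \<open>t = s * s\<close>.\<close>

lemma positive_square:
  assumes u: "star u = (u::'a::cstar_algebra)" shows "positive (u * u)"
proof -
  define s where "s = norm u + 1"
  have s: "s > 0" by (simp add: s_def add_nonneg_pos)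
  define v where "v = (1/s) *\<^sub>R u"
  have nv: "norm v < 1" using s by (simp add: v_def s_def)
  have v: "star v = v" by (simp add: v_def star_scaleR u)
  have "norm (v * v) < 1"
    using norm_mult_ineq[of v v] mult_strict_mono'[OF nv nv] by simp
  then obtain w where w: "star w = w" "w * w = 1 - v * v" "w * v = v * w"
    using selfadjoint_sqrt[of "v * v" v] by (metis v star_mult mult.assoc)
  have "norm w \<le> 1"
    by (rule norm_le_1_of_unit_circle(2)[of v w]) (use v w in auto)
  then have "norm (w * w) \<le> 1" using norm_mult_ineq[of w w] mult_mono[of "norm w" 1 "norm w" 1] by simp
  then have "norm ((s * s) *\<^sub>R (1 - v * v)) \<le> s * s" using s by (simp add: w(2))
  moreover have "(s * s) *\<^sub>R (1 - v * v) = (s * s) *\<^sub>R 1 - u * u"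
    using s by (simp add: v_def algebra_simps)
  ultimately show ?thesis using s u
    by (auto simp: positive_def star_mult intro!: exI[of _ "s * s"])
qed

section \<open>A random walk in place of spectral theory\<close>

lemma power_commute_elem: "x * y = y * x \<Longrightarrow> x ^ n * y = y * x ^ (n::nat)" for x y :: "'a::monoid_mult"
  by (induction n) (simp_all add: mult.assoc flip: power_Suc2, metis mult.assoc)

text \<open>The element on the left is the second moment of a \<open>\<plusminus>1\<close>-valued random walk of \<open>n\<close> steps
started at \<open>c\<close>, whose steps have the formal weights \<open>(1 \<plusminus> x) / 2\<close>.\<close>

lemma random_walk_moment_bound:
  fixes x v :: "'a::real_normed_algebra_1"
  assumes C: "\<And>i j. norm ((1 + x) ^ i * (1 - x) ^ j * v) \<le> C"
  shows "norm (((c\<^sup>2 + n) *\<^sub>R 1 + (2 * c * n) *\<^sub>R x + (real n * (real n - 1)) *\<^sub>R (x * x))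
    * ((1 + x) ^ i * (1 - x) ^ j * v)) \<le> (c\<^sup>2 + n) * C"
proof (induction n arbitrary: c i j)
  case 0
  then show ?case using mult_left_mono[OF C[of i j], of "c\<^sup>2"] by simp
next
  case (Suc n)
  define q where "q = (\<lambda>(n::nat) (c::real). (c\<^sup>2 + n) *\<^sub>R 1 + (2 * c * n) *\<^sub>R x + (real n * (real n - 1)) *\<^sub>R (x * x))"
  define W where "W = (1 + x) ^ i * (1 - x) ^ j * v"
  have W1: "(1 + x) * W = (1 + x) ^ Suc i * (1 - x) ^ j * v"
    by (simp add: W_def mult.assoc)
  have W2: "(1 - x) * W = (1 + x) ^ i * (1 - x) ^ Suc j * v"
  proof -
    have "(1 - x) * (1 + x) ^ i = (1 + x) ^ i * (1 - x)"
      by (rule power_commute_elem[symmetric]) (simp add: algebra_simps)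
    then show ?thesis by (simp add: W_def flip: mult.assoc)
  qed
  have expand: "(a *\<^sub>R 1 + b *\<^sub>R x + d *\<^sub>R (x * x)) * (1 + x) + (a' *\<^sub>R 1 + b' *\<^sub>R x + d *\<^sub>R (x * x)) * (1 - x)
      = (a + a') *\<^sub>R 1 + (a - a' + b + b') *\<^sub>R x + (b - b' + d + d) *\<^sub>R (x * x)" for a b a' b' d
    by (simp add: algebra_simps) (metis mult_2_right scaleR_left_distrib)
  \<comment> \<open>Conditioning on the first step: with weight
    \<open>(1 \<plusminus> x) / 2\<close> the walk restarts at \<open>c \<plusminus> 1\<close> with
    \<open>n\<close> steps left. The bound propagates because the mean of
    \<open>(c \<plusminus> 1)\<^sup>2 + n\<close> is \<open>c\<^sup>2 + n + 1\<close>.\<close>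
  have "2 *\<^sub>R q (Suc n) c = q n (c + 1) * (1 + x) + q n (c - 1) * (1 - x)"
    unfolding q_def expand scaleR_add_right scaleR_scaleR
    by (intro arg_cong2[where f = "(+)"] arg_cong2[where f = "(*\<^sub>R)"] refl)
       (simp_all add: power2_eq_square algebra_simps)
  then have "2 *\<^sub>R (q (Suc n) c * W) = q n (c + 1) * ((1 + x) * W) + q n (c - 1) * ((1 - x) * W)"
    by (metis scaleR_left_distrib mult_scaleR_left distrib_right mult.assoc)
  moreover have "norm (q n (c + 1) * ((1 + x) * W)) \<le> ((c + 1)\<^sup>2 + n) * C"
    unfolding W1 q_def by (rule Suc)
  moreover have "norm (q n (c - 1) * ((1 - x) * W)) \<le> ((c - 1)\<^sup>2 + n) * C"
    unfolding W2 q_def by (rule Suc)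
  ultimately have "norm (2 *\<^sub>R (q (Suc n) c * W)) \<le> ((c + 1)\<^sup>2 + n) * C + ((c - 1)\<^sup>2 + n) * C"
    by (simp only:) (intro norm_triangle_le add_mono; assumption)
  then have "norm (q (Suc n) c * W) \<le> (c\<^sup>2 + Suc n) * C"
    by (simp add: power2_eq_square algebra_simps)
  then show ?case by (simp add: q_def W_def)
qed

text \<open>For the walk started at 0 the second moment is
  \<open>n *\<^sub>R 1 + (n * (n - 1)) *\<^sub>R (x * x)\<close>. Applied to \<open>v\<close> it is
  bounded linearly in \<open>n\<close>, while its second coefficient grows quadratically.\<close>

lemma square_mult_eq_0_of_bound:
  fixes x v :: "'a::real_normed_algebra_1"
  assumes C: "\<And>i j. norm ((1 + x) ^ i * (1 - x) ^ j * v) \<le> C"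
  shows "x * x * v = 0"
proof -
  have C0: "norm v \<le> C" using C[of 0 0] by simp
  have "(real n - 1) * norm (x * x * v) \<le> 2 * C" if n: "n \<ge> 1" for n :: nat
  proof -
    let ?y = "(real n * (real n - 1)) *\<^sub>R (x * x * v)"
    have "norm (real n *\<^sub>R v + ?y) \<le> real n * C"
      using random_walk_moment_bound[OF C, of 0 n 0 0] by (simp add: distrib_right)
    moreover have "norm ?y \<le> norm (real n *\<^sub>R v + ?y) + norm (real n *\<^sub>R v)"
      by (metis add_diff_cancel_left' norm_triangle_ineq4)
    moreover have "norm (real n *\<^sub>R v) \<le> real n * C" using C0 by (simp add: mult_left_mono)
    ultimately have "norm ?y \<le> real n * (2 * C)" by (simp add: algebra_simps)
    moreover have "norm ?y = real n * ((real n - 1) * norm (x * x * v))"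
    proof -
      have "0 \<le> real n * (real n - 1)" using n by simp
      then show ?thesis by (simp only: norm_scaleR abs_of_nonneg mult.assoc)
    qed
    ultimately have "real n * ((real n - 1) * norm (x * x * v)) \<le> real n * (2 * C)" by (simp only:)
    then show ?thesis using n by (subst (asm) mult_le_cancel_left_pos) auto
  qed
  then have b: "real m * norm (x * x * v) \<le> 2 * C" for m
    by (metis Suc_le_mono add_diff_cancel_left' le0 of_nat_Suc One_nat_def)
  show ?thesis
  proof (rule ccontr)
    assume "x * x * v \<noteq> 0"
    then have "norm (x * x * v) > 0" by simp
    from ex_less_of_nat_mult[OF this, of "2 * C"] b show False by (meson not_le)
  qed
qed

lemma norm_power_le_1: "norm x \<le> 1 \<Longrightarrow> norm (x ^ n) \<le> 1" for x :: "'a::real_normed_algebra_1"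
  by (meson norm_power_ineq norm_ge_zero order_trans power_le_one)

lemma norm_mult_le_1: "norm x \<le> 1 \<Longrightarrow> norm (x * y) \<le> norm y" for x :: "'a::real_normed_algebra_1"
  by (metis mult_left_le_one_le norm_ge_zero norm_mult_ineq order_trans)

text \<open>All small \<open>r\<close> are covered so that two positive elements can be normalized
  by a common factor. The bound is convexity: \<open>1 - r *\<^sub>R h\<close> combines
  \<open>1\<close> and \<open>t *\<^sub>R 1 - h\<close> with weights \<open>1 - r * t\<close> and
  \<open>r\<close>.\<close>

lemma positive_normalize:
  assumes "positive h"
  shows "\<exists>s>0. \<forall>r. 0 < r \<and> r \<le> s \<longrightarrow> norm (1 - r *\<^sub>R h) \<le> 1"
proof -
  obtain t where t: "0 \<le> t" "norm (t *\<^sub>R 1 - h) \<le> t" using assms by (auto simp: positive_def)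
  show ?thesis
  proof (intro exI[of _ "1 / (t + 1)"] conjI allI impI)
    show "1 / (t + 1) > 0" using t by simp
    fix r :: real assume "0 < r \<and> r \<le> 1 / (t + 1)"
    then have r: "0 < r" "r \<le> 1 / (t + 1)" by auto
    have "r * (t + 1) \<le> 1" using r(2) t by (simp add: field_simps)
    then have rt: "r * t \<le> 1" using r(1) by (simp add: algebra_simps)
    have "1 - r *\<^sub>R h = (1 - r * t) *\<^sub>R 1 + r *\<^sub>R (t *\<^sub>R 1 - h)" by (simp add: algebra_simps)
    then have "norm (1 - r *\<^sub>R h) \<le> norm ((1 - r * t) *\<^sub>R (1::'a)) + norm (r *\<^sub>R (t *\<^sub>R 1 - h))"
      by (simp only: norm_triangle_ineq)
    also have "\<dots> = (1 - r * t) + r * norm (t *\<^sub>R 1 - h)" using rt r by simp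
    also have "\<dots> \<le> (1 - r * t) + r * t" using t r by (intro add_left_mono mult_left_mono) auto
    finally show "norm (1 - r *\<^sub>R h) \<le> 1" by simp
  qed
qed

text \<open>For a small multiple \<open>x\<close> of \<open>h\<close> both \<open>1 + x\<close> and
  \<open>1 - x\<close> are contractions, so their mixed products are bounded and the random walk
  estimate forces \<open>x * x = 0\<close>.\<close>

lemma positive_antisym:
  assumes "positive h" "positive (- h)" shows "h = 0"
proof -
  obtain s where s: "s > 0" "\<And>r. 0 < r \<Longrightarrow> r \<le> s \<Longrightarrow> norm (1 - r *\<^sub>R h) \<le> 1"
    using positive_normalize[OF assms(1)] by blast
  obtain s' where s': "s' > 0" "\<And>r. 0 < r \<Longrightarrow> r \<le> s' \<Longrightarrow> norm (1 - r *\<^sub>R (- h)) \<le> 1"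
    using positive_normalize[OF assms(2)] by blast
  define x where "x = min s s' *\<^sub>R h"
  have n: "norm (1 - x) \<le> 1" "norm (1 + x) \<le> 1"
    using s(2)[of "min s s'"] s'(2)[of "min s s'"] s(1) s'(1) by (auto simp: x_def)
  have "norm ((1 + x) ^ i * (1 - x) ^ j * 1) \<le> 1" for i j
    using norm_mult_le_1[of "(1 + x) ^ i" "(1 - x) ^ j"] norm_power_le_1[OF n(1), of j]
      norm_power_le_1[OF n(2), of i] by simp
  from square_mult_eq_0_of_bound[OF this] have "x * x = 0" by simp
  moreover have "star x = x" using assms(1) by (simp add: x_def positive_def star_scaleR)
  ultimately have "x = 0" using selfadjoint_square_eq_0 by blast
  then show ?thesis using s(1) s'(1) by (simp add: x_def min_def split: if_splits)
qed

lemma cartesian_decomposition: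
  obtains u w where "star u = u" "star w = w" "y = u + \<i> *\<^sub>C (w::'a::cstar_algebra)"
proof
  let ?u = "(1/2) *\<^sub>C (y + star y)" and ?w = "(- \<i>/2) *\<^sub>C (y - star y)"
  show "star ?u = ?u" by (simp add: star_scaleC star_add star_star add.commute)
  show "star ?w = ?w"
    by (simp add: star_scaleC star_diff star_star scaleC_diff_right scaleC_minus_left)
  have "?u + \<i> *\<^sub>C ?w = (1/2 + 1/2) *\<^sub>C y"
    unfolding scaleC_add_left by (simp add: scaleC_scaleC scaleC_add_right scaleC_diff_right)
  then show "y = ?u + \<i> *\<^sub>C ?w" by (simp add: scaleC_one)
qed

text \<open>Kaplansky's argument: \<open>y y\<^sup>* = 2 u\<^sup>2 + 2 w\<^sup>2 - y\<^sup>* y\<close> is positive while, having the same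
nonzero spectrum as \<open>y\<^sup>* y\<close>, it should be negative. The latter enters through
\<open>(1 + y y\<^sup>*)\<^sup>n y = y (1 + y\<^sup>* y)\<^sup>n\<close>.\<close>

lemma star_mult_self_not_negative:
  fixes y :: "'a::cstar_algebra"
  assumes h: "positive h" and y: "star y * y = - h"
  shows "y = 0"
proof -
  obtain u w where uw: "star u = u" "star w = w" and yuw: "y = u + \<i> *\<^sub>C w"
    by (rule cartesian_decomposition)
  have "y * star y + star y * y = (u * u + u * u) + (w * w + w * w)"
    unfolding yuw star_add star_scaleC uw
    by (simp add: algebra_simps mult_scaleC_left mult_scaleC_right scaleC_scaleC scaleC_minus_left
        scaleC_minus_one scaleC_minus_right scaleC_one scaleC_add_right scaleC_diff_right)
  then have "y * star y = (u * u + u * u) + (w * w + w * w) + h" by (simp add: y algebra_simps)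
  then have pos: "positive (y * star y)"
    by (simp add: positive_add positive_square h uw)
  obtain s where s: "s > 0" "\<And>r. 0 < r \<Longrightarrow> r \<le> s \<Longrightarrow> norm (1 - r *\<^sub>R h) \<le> 1"
    using positive_normalize[OF h] by blast
  obtain s' where s': "s' > 0" "\<And>r. 0 < r \<Longrightarrow> r \<le> s' \<Longrightarrow> norm (1 - r *\<^sub>R (y * star y)) \<le> 1"
    using positive_normalize[OF pos] by blast
  define r where "r = min s s'"
  define k m where "k = r *\<^sub>R (y * star y)" and "m = r *\<^sub>R (star y * y)"
  have r: "r > 0" "norm (1 + m) \<le> 1" "norm (1 - k) \<le> 1"
    using s(2)[of r] s'(2)[of r] s(1) s'(1) by (auto simp: r_def m_def k_def y)
  have sk: "star k = k" by (simp add: k_def star_scaleR star_mult star_star)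
  \<comment> \<open>The available contractions are \<open>1 - k\<close> and \<open>1 + m\<close>;
    moving powers of \<open>1 + k\<close> across \<open>y\<close> turns them into powers of
    \<open>1 + m\<close>.\<close>
  have intertwine: "(1 + k) ^ i * y = y * (1 + m) ^ i" for i
  proof (induction i)
    case (Suc i)
    have "(1 + k) ^ Suc i * y = (1 + k) * (y * (1 + m) ^ i)" using Suc by (simp add: mult.assoc)
    also have "\<dots> = y * ((1 + m) * (1 + m) ^ i)" by (simp add: k_def m_def algebra_simps)
    finally show ?case by simp
  qed simp
  have "norm ((1 + k) ^ i * (1 - k) ^ j * (y * star y)) \<le> norm y * norm y" for i j
  proof -
    have c: "(1 + k) ^ i * (1 - k) ^ j = (1 - k) ^ j * (1 + k) ^ i"
      by (intro power_commute_elem power_commute_elem[symmetric]) (simp add: algebra_simps)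
    have "(1 + k) ^ i * (1 - k) ^ j * (y * star y) = (1 - k) ^ j * (y * ((1 + m) ^ i * star y))"
      unfolding c by (metis intertwine mult.assoc)
    also have "norm \<dots> \<le> norm (y * ((1 + m) ^ i * star y))"
      by (intro norm_mult_le_1 norm_power_le_1 r)
    also have "\<dots> \<le> norm y * norm ((1 + m) ^ i * star y)" by (rule norm_mult_ineq)
    also have "\<dots> \<le> norm y * norm (star y)"
      by (intro mult_left_mono norm_mult_le_1 norm_power_le_1 r) auto
    finally show ?thesis by (simp add: norm_star)
  qed
  from square_mult_eq_0_of_bound[OF this] have "k * k * (y * star y) = 0" .
  then have "k * k * k = 0" by (simp add: k_def)
  \<comment> \<open>The fourth power is the square of a square, so self-adjointness can be used to
    cancel twice.\<close>
  then have "(k * k) * (k * k) = 0" by (simp flip: mult.assoc)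
  then have "k * k = 0" using selfadjoint_square_eq_0[of "k * k"] by (simp add: star_mult sk)
  then have "k = 0" using selfadjoint_square_eq_0[of k] sk by simp
  then have "star (star y) * star y = 0" using r(1) by (simp add: k_def star_star)
  then have "star y = 0" by (simp only: star_mult_self_eq_0_iff)
  then show ?thesis by (metis star_star star_zero)
qed

text \<open>\<open>t *\<^sub>R 1 - p * h * p\<close> is block diagonal: \<open>t\<close> on
  \<open>1 - p\<close>, and some \<open>b\<close> with \<open>norm b \<le> t\<close> on
  \<open>p\<close>. The triangle inequality loses a factor 2, but the same factor for every power,
  so the power bound removes it.\<close>

lemma positive_compress:
  fixes p :: "'a::cstar_algebra"
  assumes p: "p * p = p" "star p = p" and h: "positive h"
  shows "positive (p * h * p)"
proof -
  obtain t where t: "t \<ge> 0" "norm (t *\<^sub>R 1 - h) \<le> t" using h by (auto simp: positive_def)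
  have np: "norm q \<le> 1" if "q * q = q" "star q = q" for q :: 'a
  proof -
    have "norm q * norm q = norm q * 1" using cstar_identity[of q] that by (simp add: power2_eq_square)
    then show ?thesis by (cases "norm q = 0") auto
  qed
  define b where "b = p * (t *\<^sub>R 1 - h) * p"
  have pb: "p * b = b" "b * p = b" 
    by (simp_all add: b_def mult.assoc p) (simp_all flip: mult.assoc add: p)
  have nb: "norm b \<le> t"
  proof -
    have "norm b \<le> norm p * norm (t *\<^sub>R 1 - h) * norm p" unfolding b_def
      by (meson mult_right_mono norm_ge_zero norm_mult_ineq order_trans)
    also have "\<dots> \<le> 1 * t * 1" using t np[OF p] by (intro mult_mono) auto
    finally show ?thesis by simp
  qed
  let ?a = "t *\<^sub>R 1 - p * h * p"
  have a: "?a = t *\<^sub>R (1 - p) + b" by (simp add: b_def algebra_simps p)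
  have pow: "?a ^ n = t ^ n *\<^sub>R (1 - p) + p * b ^ n" if "n > 0" for n
    using that
  proof (induction n rule: nat_induct_non_zero)
    case 1
    then show ?case unfolding a by (simp add: pb)
  next
    case (Suc n)
    have bn: "b * b ^ n = b ^ n * b" "p * b ^ n = b ^ n * p"
      using power_commute_elem[of b p n] pb by (auto simp: power_commutes)
    have "?a ^ Suc n = (t *\<^sub>R (1 - p) + b) * (t ^ n *\<^sub>R (1 - p) + p * b ^ n)"
      by (simp only: power_Suc Suc) (simp only: a)
    also have "\<dots> = (t * t ^ n) *\<^sub>R ((1 - p) * (1 - p)) + t *\<^sub>R ((1 - p) * p * b ^ n)
       + t ^ n *\<^sub>R (b * (1 - p)) + b * p * b ^ n"
      by (simp add: algebra_simps)
    also have "\<dots> = t ^ Suc n *\<^sub>R (1 - p) + p * b ^ Suc n"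
      by (simp add: algebra_simps p pb) (simp flip: mult.assoc add: pb)
    finally show ?case .
  qed
  have "norm (?a ^ n) \<le> 2 * t ^ n" for n
  proof (cases "n = 0")
    case False
    have np1: "norm (1 - p) \<le> 1" by (rule np) (simp_all add: algebra_simps p star_diff)
    have "norm (p * b ^ n) \<le> norm (b ^ n)" by (rule norm_mult_le_1[OF np[OF p]])
    also have "\<dots> \<le> t ^ n" by (meson nb norm_ge_zero norm_power_ineq order_trans power_mono)
    finally have "norm (p * b ^ n) \<le> t ^ n" .
    moreover have "norm (t ^ n *\<^sub>R (1 - p)) \<le> t ^ n"
      using t np1 by (simp add: mult_left_le)
    ultimately show ?thesis using False pow[of n] norm_triangle_ineq[of "t ^ n *\<^sub>R (1 - p)" "p * b ^ n"]
      by simp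
  qed simp
  moreover have "star ?a = ?a" and "star (p * h * p) = p * h * p"
    using h by (simp_all add: star_diff star_scaleR star_mult p positive_def mult.assoc)
  ultimately show ?thesis using t(1) norm_le_of_power_bound[of ?a t 2] by (auto simp: positive_def)
qed

text \<open>Compressing \<open>1 - (\<Sum>j<n. q j)\<close> by \<open>q i\<close> cancels the term
  of \<open>q i\<close> against \<open>1\<close> and exhibits
  \<open>star (z * q i) * (z * q i)\<close> as minus a sum of positive elements
  \<open>q i * q k * q i\<close>. It therefore vanishes, and so does each summand; the summand for
  \<open>j\<close> equals \<open>star (q j * q i) * (q j * q i)\<close>.\<close>

lemma projections_orthogonal:
  fixes q :: "nat \<Rightarrow> 'a::cstar_algebra"
  assumes q: "\<And>i. q i * q i = q i" "\<And>i. star (q i) = q i"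
    and le: "\<And>n. \<exists>z. 1 - (\<Sum>j<n. q j) = star z * z"
    and ij: "i \<noteq> j"
  shows "q j * q i = 0"
proof -
  define n where "n = Suc (max i j)"
  have n: "i < n" "j < n" by (auto simp: n_def)
  obtain z where z: "1 - (\<Sum>j<n. q j) = star z * z" using le by blast
  define J where "J = {..<n} - {i}"
  define c where "c k = q i * q k * q i" for k
  have pc: "positive (c k)" for k
    unfolding c_def using positive_compress[OF q(1)[of i] q(2)[of i] positive_square[OF q(2)[of k]]]
    by (simp add: q)
  have "star (z * q i) * (z * q i) = q i * (star z * z) * q i" by (simp add: star_mult q mult.assoc)
  also have "\<dots> = q i * (1 - (q i + sum q J)) * q i"
    unfolding z[symmetric] J_def using n by (subst sum.remove[of _ i]) auto
  also have "\<dots> = - sum c J"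
    by (simp add: c_def algebra_simps q sum_distrib_left sum_distrib_right)
  finally have eq: "star (z * q i) * (z * q i) = - sum c J" .
  have "z * q i = 0"
    by (rule star_mult_self_not_negative[OF _ eq]) (intro positive_sum pc)
  with eq have "c j + sum c (J - {j}) = 0"
    using n ij by (subst sum.remove[symmetric]) (auto simp: J_def)
  then have "- c j = sum c (J - {j})" by (simp add: eq_neg_iff_add_eq_0 neg_eq_iff_add_eq_0)
  then have "positive (- c j)" by (simp only:) (intro positive_sum pc)
  then have "c j = 0" using positive_antisym[OF pc] by blast
  then have "star (q j * q i) * (q j * q i) = 0"
    by (simp add: c_def star_mult q mult.assoc) (simp flip: mult.assoc add: q)
  then show ?thesis by (simp only: star_mult_self_eq_0_iff)
qed

section \<open>The dense subalgebra spanned by words\<close>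

inductive_set word_span :: "(nat \<Rightarrow> 'a::cstar_algebra) \<Rightarrow> 'a set" for S
  where
    word: "word_prod S \<mu> * star (word_prod S \<nu>) \<in> word_span S"
  | add: "x \<in> word_span S \<Longrightarrow> y \<in> word_span S \<Longrightarrow> x + y \<in> word_span S"
  | scale: "x \<in> word_span S \<Longrightarrow> a *\<^sub>C x \<in> word_span S"

lemma word_prod_Nil [simp]: "word_prod S [] = 1"
  and word_prod_Cons: "word_prod S (i # \<mu>) = S i * word_prod S \<mu>"
  and word_prod_append: "word_prod S (\<mu> @ \<nu>) = word_prod S \<mu> * word_prod S \<nu>"
  by (simp_all add: word_prod_def)

lemma word_span_one: "1 \<in> word_span S"
  using word_span.word[of S "[]" "[]"] by simp

lemma word_span_zero: "0 \<in> word_span S"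
  using word_span.scale[OF word_span_one, of 0] by simp

lemma word_span_diff: "x \<in> word_span S \<Longrightarrow> y \<in> word_span S \<Longrightarrow> x - y \<in> word_span S"
  using word_span.add[of x S "- y"] word_span.scale[of y S "-1"] by (simp add: scaleC_minus_one)

lemma word_span_sum: "(\<And>i. i \<in> I \<Longrightarrow> f i \<in> word_span S) \<Longrightarrow> sum f I \<in> word_span S"
  by (induction I rule: infinite_finite_induct) (auto simp: word_span_zero intro: word_span.add)

locale OA_inf_algebra =
  fixes N :: nat and A :: "nat mat" and S :: "nat \<Rightarrow> 'a::cstar_algebra"
  assumes partial_isometry: "S i * star (S i) * S i = S i"
    and range_sum_le_1: "\<exists>z. 1 - (\<Sum>j<n. S j * star (S j)) = star z * z"
    and source: "i < N \<Longrightarrow> star (S i) * S i = (\<Sum>j<N. of_nat (A $$ (i, j)) *\<^sub>C (S j * star (S j)))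
      + (1 - (\<Sum>j<N. S j * star (S j)))"
    and isometry: "i \<ge> N \<Longrightarrow> star (S i) * S i = 1"
    and generated: "closure (star_alg_gen S) = UNIV"
begin

abbreviation "W \<equiv> word_prod S"
abbreviation "P \<equiv> P_proj N S"

lemma orthogonal: "i \<noteq> j \<Longrightarrow> star (S i) * S j = 0"
proof -
  assume ij: "i \<noteq> j"
  let ?q = "\<lambda>i. S i * star (S i)"
  have q: "?q i * ?q i = ?q i" for i by (metis partial_isometry mult.assoc)
  have "?q i * ?q j = 0"
    by (rule projections_orthogonal[of ?q])
       (use q range_sum_le_1 ij in \<open>auto simp: star_mult star_star\<close>)
  then have "star (S i) * ?q i * (?q j * S j) = 0" by (metis mult.assoc mult_zero_left mult_zero_right)
  moreover have "star (S i) * ?q i = star (S i)"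
    using arg_cong[OF partial_isometry[of i], of star] by (simp add: star_mult star_star mult.assoc)
  ultimately show ?thesis by (simp add: partial_isometry)
qed

lemma S_word_span: "x \<in> word_span S \<Longrightarrow> S i * x \<in> word_span S"
proof (induction rule: word_span.induct)
  case (word \<mu> \<nu>)
  then show ?case using word_span.word[of S "i # \<mu>" \<nu>] by (simp add: word_prod_Cons mult.assoc)
qed (auto simp: distrib_left mult_scaleC_right intro: word_span.intros)

text \<open>The case with content is a matching first letter below \<open>N\<close>. There
  \<open>star (S i) * S i\<close> is a combination of \<open>1\<close> and range projections
  \<open>S k * star (S k)\<close>, and \<open>star (S k)\<close> meets the shorter word, so the
  induction hypothesis is needed for every index \<open>k\<close>.\<close>

lemma star_S_word: "star (S i) * (W \<mu> * star (W \<nu>)) \<in> word_span S"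
proof (induction \<mu> arbitrary: i)
  case Nil
  then show ?case using word_span.word[of S "[]" "\<nu> @ [i]"]
    by (simp add: word_prod_append word_prod_Cons star_mult)
next
  case (Cons j \<mu>)
  let ?y = "W \<mu> * star (W \<nu>)"
  have y: "?y \<in> word_span S" by (rule word_span.word)
  have q: "S k * star (S k) * ?y \<in> word_span S" for k
    using S_word_span[OF Cons.IH[of k], of k] by (simp add: mult.assoc)
  have eq: "star (S i) * (W (j # \<mu>) * star (W \<nu>)) = star (S i) * S j * ?y"
    by (simp add: word_prod_Cons mult.assoc)
  consider "i \<noteq> j" | "i = j" "i < N" | "i = j" "i \<ge> N" by linarith
  then show ?case
  proof cases
    case 1
    then show ?thesis by (simp add: eq orthogonal word_span_zero)
  next
    case 2
    have "star (S i) * S i * ?y \<in> word_span S"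
      unfolding source[OF 2(2)] distrib_right left_diff_distrib sum_distrib_right mult_scaleC_left mult_1_left
      by (intro word_span.add word_span_diff word_span_sum word_span.scale y q)
    then show ?thesis unfolding eq using 2 by simp
  next
    case 3
    then show ?thesis unfolding eq using y by (simp add: isometry)
  qed
qed

lemma star_S_word_span: "x \<in> word_span S \<Longrightarrow> star (S i) * x \<in> word_span S"
  by (induction rule: word_span.induct)
     (auto simp: distrib_left mult_scaleC_right intro: word_span.intros star_S_word)

text \<open>Both claims are proved together because the adjoint case of the induction exchanges
  them.\<close>

lemma star_alg_gen_mult_word_span:
  assumes "x \<in> star_alg_gen S" "y \<in> word_span S"
  shows "x * y \<in> word_span S" "star x * y \<in> word_span S"
proof -
  have "\<forall>y\<in>word_span S. x * y \<in> word_span S \<and> star x * y \<in> word_span S"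
    using assms(1)
    by induction (auto simp: S_word_span star_S_word_span distrib_right star_add star_mult star_star
        mult_scaleC_left star_scaleC mult.assoc intro: word_span.intros)
  with assms(2) show "x * y \<in> word_span S" "star x * y \<in> word_span S" by auto
qed

lemma closure_word_span: "closure (word_span S) = UNIV"
proof -
  have "star_alg_gen S \<subseteq> word_span S"
    using star_alg_gen_mult_word_span(1)[OF _ word_span_one] by auto
  then show ?thesis using closure_mono[of "star_alg_gen S" "word_span S"] generated by auto
qed

lemma word_span_approx:
  obtains f where "\<And>n. f n \<in> word_span S" "f \<longlonglongrightarrow> x"
  using closure_word_span closure_sequential[of x "word_span S"] by auto

lemma word_prod_gen: "W \<mu> \<in> star_alg_gen S"
  by (induction \<mu>) (auto simp: word_prod_Cons intro: star_alg_gen.intros)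

lemma P_selfadjoint: "star P = P"
  by (simp add: P_proj_def star_diff star_sum star_mult star_star)

lemma P_S: "P * S i = (if i < N then 0 else S i)"
proof -
  have "(\<Sum>j<N. S j * star (S j)) * S i = (\<Sum>j<N. if j = i then S i else 0)"
    unfolding sum_distrib_right
    by (rule sum.cong) (auto simp: partial_isometry, simp add: mult.assoc orthogonal)
  then show ?thesis by (simp add: P_proj_def left_diff_distrib)
qed

lemma P_idem: "P * P = P"
proof -
  have "P * (\<Sum>j<N. S j * star (S j)) = 0"
    by (simp add: sum_distrib_left P_S flip: mult.assoc)
  then show ?thesis by (subst (2) P_proj_def) (simp add: right_diff_distrib)
qed

lemma corner_P_iff: "x \<in> corner P \<longleftrightarrow> P * x * P = x"
proof
  assume "x \<in> corner P"
  then obtain y where "x = P * y * P" by (auto simp: corner_def)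
  then show "P * x * P = x" by (simp add: mult.assoc P_idem) (simp flip: mult.assoc add: P_idem)
next
  assume "P * x * P = x"
  then show "x \<in> corner P" unfolding corner_def by (intro CollectI exI[of _ x]) simp
qed

lemma corner_P_unit: "x \<in> corner P \<Longrightarrow> P * x = x" "x \<in> corner P \<Longrightarrow> x * P = x"
  unfolding corner_P_iff by (metis P_idem mult.assoc)+

lemma corner_P_intro: "P * x = x \<Longrightarrow> x * P = x \<Longrightarrow> x \<in> corner P"
  by (simp add: corner_P_iff)

lemma corner_P_closed:
  "x \<in> corner P \<Longrightarrow> y \<in> corner P \<Longrightarrow> x + y \<in> corner P"
  "x \<in> corner P \<Longrightarrow> a *\<^sub>C x \<in> corner P"
  "x \<in> corner P \<Longrightarrow> y \<in> corner P \<Longrightarrow> x * y \<in> corner P"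
  "x \<in> corner P \<Longrightarrow> star x \<in> corner P"
  "P \<in> corner P" "P * z * P \<in> corner P"
proof -
  show "x \<in> corner P \<Longrightarrow> y \<in> corner P \<Longrightarrow> x + y \<in> corner P"
    by (intro corner_P_intro) (simp_all add: distrib_left distrib_right corner_P_unit)
  show "x \<in> corner P \<Longrightarrow> a *\<^sub>C x \<in> corner P"
    by (intro corner_P_intro) (simp_all add: mult_scaleC_left mult_scaleC_right corner_P_unit)
  show "x \<in> corner P \<Longrightarrow> y \<in> corner P \<Longrightarrow> x * y \<in> corner P"
    by (intro corner_P_intro) (metis corner_P_unit mult.assoc)+
  show "x \<in> corner P \<Longrightarrow> star x \<in> corner P"
    by (intro corner_P_intro) (metis corner_P_unit star_mult P_selfadjoint)+
  show "P \<in> corner P" by (simp add: corner_P_intro P_idem)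
  show "P * z * P \<in> corner P" by (auto simp: corner_def)
qed

lemma norm_P_le_1: "norm P \<le> 1"
proof -
  have "norm P * norm P = norm P * 1"
    using cstar_identity[of P] by (simp add: P_selfadjoint P_idem power2_eq_square)
  then show ?thesis by (cases "norm P = 0") auto
qed

end

section \<open>States and actions\<close>

text \<open>Polarization: the form at \<open>x + c *\<^sub>C y\<close> is real for
  \<open>c = 1\<close> and for \<open>c = \<i>\<close>. A general \<open>B\<close> serves both the
  whole algebra and the corner.\<close>

lemma state_hermitian:
  assumes st: "state B e \<psi>" and x: "x \<in> B" "y \<in> B"
    and B: "\<And>x y. x \<in> B \<Longrightarrow> y \<in> B \<Longrightarrow> x + y \<in> B" "\<And>a x. x \<in> B \<Longrightarrow> a *\<^sub>C x \<in> B"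
      "\<And>x y. x \<in> B \<Longrightarrow> y \<in> B \<Longrightarrow> star x * y \<in> B"
  shows "\<psi> (star y * x) = cnj (\<psi> (star x * y))"
proof -
  have add: "\<psi> (a + b) = \<psi> a + \<psi> b" if "a \<in> B" "b \<in> B" for a b
    using st that by (auto simp: state_def)
  have scale: "\<psi> (c *\<^sub>C a) = c * \<psi> a" if "a \<in> B" for a c
    using st that by (auto simp: state_def)
  have pos: "Im (\<psi> (star a * a)) = 0" if "a \<in> B" for a
    using st that by (auto simp: state_def)
  have exp: "\<psi> (star (x + c *\<^sub>C y) * (x + c *\<^sub>C y))
      = \<psi> (star x * x) + c * \<psi> (star x * y) + cnj c * \<psi> (star y * x) + cnj c * c * \<psi> (star y * y)" for c
  proof -
    have "star (x + c *\<^sub>C y) * (x + c *\<^sub>C y)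
      = star x * x + c *\<^sub>C (star x * y) + cnj c *\<^sub>C (star y * x) + (cnj c * c) *\<^sub>C (star y * y)"
      by (simp add: star_add star_scaleC algebra_simps mult_scaleC_left mult_scaleC_right scaleC_scaleC
          scaleC_add_right)
    then show ?thesis by (simp add: add scale B x)
  qed
  have "x + c *\<^sub>C y \<in> B" for c by (simp add: B x)
  from pos[OF this] have *: "Im (c * \<psi> (star x * y) + cnj c * \<psi> (star y * x)) = 0" for c
    using pos[OF x(1)] pos[OF x(2)] unfolding exp by (simp add: complex_eq_iff)
  show ?thesis using *[of 1] *[of \<i>] by (auto simp: complex_eq_iff)
qed

locale state_on =
  fixes \<phi> :: "'a::cstar_algebra \<Rightarrow> complex"
  assumes state: "state UNIV 1 \<phi>"
begin

lemma add: "\<phi> (x + y) = \<phi> x + \<phi> y"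
  and scaleC: "\<phi> (a *\<^sub>C x) = a * \<phi> x"
  and Im_pos: "Im (\<phi> (star x * x)) = 0"
  and Re_pos: "0 \<le> Re (\<phi> (star x * x))"
  and one: "\<phi> 1 = 1"
  using state by (auto simp: state_def)

lemma hermitian: "\<phi> (star y * x) = cnj (\<phi> (star x * y))"
  by (rule state_hermitian[OF state]) auto

lemma scaleR: "\<phi> (r *\<^sub>R x) = r *\<^sub>R \<phi> x"
  by (simp add: scaleR_scaleC scaleC scaleR_conv_of_real)

lemma linear: "linear \<phi>"
  by (rule linearI) (simp_all add: add scaleR)

lemmas diff = linear_diff[OF linear]
lemmas sum = linear_sum[OF linear]

lemma real_form: "\<phi> (star x * x) = of_real (Re (\<phi> (star x * x)))"
  by (simp add: complex_eq_iff Im_pos)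

lemma Cauchy_Schwarz:
  "(cmod (\<phi> (star x * y)))\<^sup>2 \<le> Re (\<phi> (star x * x)) * Re (\<phi> (star y * y))"
proof -
  define a b c where "a = Re (\<phi> (star x * x))" and "b = \<phi> (star x * y)" and "c = Re (\<phi> (star y * y))"
  have ac: "0 \<le> a" "0 \<le> c" by (auto simp: a_def c_def Re_pos)
  have quad: "0 \<le> a - 2 * s * (cmod b)\<^sup>2 + s\<^sup>2 * (cmod b)\<^sup>2 * c" for s :: real
  proof -
    \<comment> \<open>The phase of \<open>d\<close> makes both cross terms equal to
      \<open>- s * (cmod b)\<^sup>2\<close>, leaving a real quadratic in \<open>s\<close>.\<close>
    define d where "d = - of_real s * cnj b"
    have "star (x + d *\<^sub>C y) * (x + d *\<^sub>C y)
      = star x * x + d *\<^sub>C (star x * y) + cnj d *\<^sub>C (star y * x) + (cnj d * d) *\<^sub>C (star y * y)"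
      by (simp add: star_add star_scaleC algebra_simps mult_scaleC_left mult_scaleC_right scaleC_scaleC
          scaleC_add_right)
    then have "\<phi> (star (x + d *\<^sub>C y) * (x + d *\<^sub>C y)) = of_real a + d * b + cnj (d * b) + (cnj d * d) * of_real c"
      by (simp add: add scaleC hermitian[of y x] b_def a_def c_def real_form[symmetric])
    also have "d * b = - of_real (s * (cmod b)\<^sup>2)"
      unfolding of_real_mult complex_norm_square by (simp add: d_def mult_ac)
    also have "cnj d * d = of_real (s\<^sup>2 * (cmod b)\<^sup>2)"
      unfolding of_real_mult complex_norm_square by (simp add: d_def power2_eq_square mult_ac)
    finally show ?thesis using Re_pos[of "x + d *\<^sub>C y"] by simp
  qed
  show ?thesis
  proof (cases "c = 0")
    case True
    have "(cmod b)\<^sup>2 = 0"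
    proof (rule ccontr)
      assume "(cmod b)\<^sup>2 \<noteq> 0"
      then have "2 * ((a + 1) / (2 * (cmod b)\<^sup>2)) * (cmod b)\<^sup>2 = a + 1" by simp
      with quad[of "(a + 1) / (2 * (cmod b)\<^sup>2)"] True show False by simp
    qed
    then show ?thesis using ac by (simp add: a_def b_def c_def)
  next
    case False
    with ac have c: "c > 0" by simp
    have "0 \<le> a - 2 * (1 / c) * (cmod b)\<^sup>2 + (1 / c)\<^sup>2 * (cmod b)\<^sup>2 * c" by (rule quad)
    also have "\<dots> = a - (cmod b)\<^sup>2 / c" using c by (simp add: power2_eq_square field_simps)
    finally show ?thesis using c by (simp add: a_def b_def c_def field_simps)
  qed
qed

text \<open>For \<open>c > (norm x)\<^sup>2\<close> the element
  \<open>1 - (1/c) *\<^sub>R (star x * x)\<close> is the square of a self-adjoint element, so the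
  state is nonnegative on it. The slack \<open>e\<close> provides the strict inequality that the
  square root requires.\<close>

lemma Re_le_norm_square: "Re (\<phi> (star x * x)) \<le> (norm x)\<^sup>2"
proof (rule field_le_epsilon)
  fix e :: real assume e: "e > 0"
  define c where "c = (norm x)\<^sup>2 + e"
  have c: "c > 0" using e by (simp add: c_def add_nonneg_pos)
  define k where "k = (1/c) *\<^sub>R (star x * x)"
  have "norm k = (norm x)\<^sup>2 / c" using c by (simp add: k_def cstar_identity)
  then have "norm k < 1" using c e by (simp add: c_def)
  moreover have "star k = k" by (simp add: k_def star_scaleR star_mult star_star)
  ultimately obtain w where w: "star w = w" "w * w = 1 - k"
    using selfadjoint_sqrt[of k 1] by auto
  have "0 \<le> Re (\<phi> (1 - k))" using Re_pos[of w] w by simp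
  then have "Re (\<phi> (star x * x)) / c \<le> 1" by (simp add: diff one k_def scaleR)
  then show "Re (\<phi> (star x * x)) \<le> (norm x)\<^sup>2 + e" using c by (simp add: c_def field_simps)
qed

lemma bound_form: "cmod (\<phi> (star x * y)) \<le> norm x * norm y"
proof -
  have "(cmod (\<phi> (star x * y)))\<^sup>2 \<le> (norm x)\<^sup>2 * (norm y)\<^sup>2"
    using Cauchy_Schwarz[of x y] mult_mono[OF Re_le_norm_square[of x] Re_le_norm_square[of y]]
    by (simp add: Re_pos)
  then have "(cmod (\<phi> (star x * y)))\<^sup>2 \<le> (norm x * norm y)\<^sup>2" by (simp only: power_mult_distrib)
  then show ?thesis by (rule power2_le_imp_le) simp
qed

lemma bound: "cmod (\<phi> x) \<le> norm x"
  using bound_form[of 1 x] by simp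

lemma bounded_linear: "bounded_linear \<phi>"
  by (rule bounded_linear_intro[where K = 1]) (simp_all add: add scaleR bound)

lemmas tendsto = bounded_linear.tendsto[OF bounded_linear]

end

locale action_on =
  fixes \<sigma> :: "real \<Rightarrow> 'a::cstar_algebra \<Rightarrow> 'a"
  assumes action: "one_parameter_action UNIV 1 \<sigma>"
begin

lemma hom: "\<sigma> t \<in> star_hom (cstar_on UNIV 1) (cstar_on UNIV 1)"
  using action by (simp add: one_parameter_action_def)

lemma add: "\<sigma> t (x + y) = \<sigma> t x + \<sigma> t y"
  and mult: "\<sigma> t (x * y) = \<sigma> t x * \<sigma> t y"
  and one: "\<sigma> t 1 = 1"
  and scaleC: "\<sigma> t (a *\<^sub>C x) = a *\<^sub>C \<sigma> t x"
  and star: "\<sigma> t (star x) = star (\<sigma> t x)"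
  using hom[of t] by (auto simp: star_hom_def ring_hom_def)

lemma scaleR: "\<sigma> t (r *\<^sub>R x) = r *\<^sub>R \<sigma> t x"
  by (simp add: scaleR_scaleC scaleC)

lemma linear: "linear (\<sigma> t)"
  by (rule linearI) (simp_all add: add scaleR)

lemmas diff = linear_diff[OF linear]
lemmas sum = linear_sum[OF linear]

lemma at_0: "\<sigma> 0 x = x" and flow: "\<sigma> (s + t) x = \<sigma> s (\<sigma> t x)"
  and orbit_continuous: "continuous_on UNIV (\<lambda>t. \<sigma> t x)"
  using action by (simp_all add: one_parameter_action_def)

lemma restrict_corner:
  assumes p: "p * p = p" and fixp: "\<And>t. \<sigma> t p = p"
  shows "one_parameter_action (corner p) p \<sigma>"
proof -
  have c: "\<sigma> t x \<in> corner p" if "x \<in> corner p" for t x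
    using that by (auto simp: corner_def mult fixp)
  have "bij_betw (\<sigma> t) (corner p) (corner p)" for t
    by (rule bij_betw_byWitness[where f' = "\<sigma> (- t)"])
       (use c flow[of t "- t"] flow[of "- t" t] in \<open>auto simp: at_0\<close>)
  moreover have "\<sigma> t \<in> star_hom (cstar_on (corner p) p) (cstar_on (corner p) p)" for t
    by (auto simp: star_hom_def ring_hom_def c add mult fixp scaleC star)
  ultimately show ?thesis
    by (auto simp: one_parameter_action_def at_0 flow orbit_continuous)
qed

lemma state_comp: "state_on \<phi> \<Longrightarrow> state_on (\<lambda>x. \<phi> (\<sigma> t x))"
  unfolding state_on_def state_def by (auto simp: add scaleC mult star one)

end

locale dynamical_state = state_on \<phi> + action: action_on \<sigma> for \<phi> :: "'a::cstar_algebra \<Rightarrow> complex" and \<sigma> :: "real \<Rightarrow> 'a \<Rightarrow> 'a"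
begin

sublocale comp: state_on "\<lambda>x. \<phi> (\<sigma> t x)" for t
  by (rule action.state_comp) unfold_locales

text \<open>The factor \<open>norm x\<close>, in place of \<open>norm (\<sigma> t x)\<close>, comes
  from applying the norm estimate to the state \<open>\<lambda>x. \<phi> (\<sigma> t x)\<close>. It
  makes later estimates uniform in \<open>t\<close>.\<close>

lemma comp_form_bound: "cmod (\<phi> (y * \<sigma> t x)) \<le> norm y * norm x"
proof -
  have "(cmod (\<phi> (y * \<sigma> t x)))\<^sup>2 \<le> Re (\<phi> (star (star y) * star y)) * Re (\<phi> (star (\<sigma> t x) * \<sigma> t x))"
    using Cauchy_Schwarz[of "star y" "\<sigma> t x"] by (simp add: star_star)
  also have "\<dots> \<le> (norm (star y))\<^sup>2 * (norm x)\<^sup>2"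
    using comp.Re_le_norm_square[of t x] Re_le_norm_square[of "star y"]
    by (intro mult_mono) (auto simp: action.mult action.star Re_pos)
  also have "\<dots> = (norm y * norm x)\<^sup>2" by (simp add: norm_star power_mult_distrib)
  finally show ?thesis by (rule power2_le_imp_le) simp
qed

end

section \<open>Bounded holomorphic functions of period one on the upper half plane\<close>

definition ephase :: "complex \<Rightarrow> complex"
  where "ephase z = exp (2 * of_real pi * \<i> * z)"

lemma phase_eq_ephase: "phase t = ephase (of_real t)"
  by (simp add: phase_def ephase_def)

lemma norm_ephase: "cmod (ephase z) = exp (- (2 * pi * Im z))"
  by (simp add: ephase_def norm_exp_eq_Re)

lemma norm_ephase_le_1: "0 \<le> Im z \<Longrightarrow> cmod (ephase z) \<le> 1"
  by (simp add: norm_ephase)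

lemma norm_phase [simp]: "cmod (phase t) = 1"
  by (simp add: phase_eq_ephase norm_ephase)

lemma ephase_add: "ephase (z + w) = ephase z * ephase w"
  by (simp add: ephase_def exp_add distrib_left)

lemma phase_add: "phase (s + t) = phase s * phase t"
  by (simp add: phase_eq_ephase ephase_add)

lemma phase_0 [simp]: "phase 0 = 1"
  by (simp add: phase_def)

lemma phase_minus_mult [simp]: "phase (- t) * phase t = 1" "phase t * phase (- t) = 1"
  using phase_add[of t "- t"] by (simp_all add: mult.commute)

lemma cnj_phase: "cnj (phase t) = phase (- t)"
  by (simp add: phase_def exp_cnj)

lemma ephase_holomorphic: "ephase holomorphic_on A"
  unfolding ephase_def by (intro holomorphic_intros)

lemma unit_circle_phase:
  assumes "cmod w = 1" obtains t where "w = phase t"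
proof
  have "w = exp (\<i> * of_real (Arg w))"
    using Arg_eq[of w] assms by force
  then show "w = phase (Arg w / (2 * pi))" by (simp add: phase_def mult_ac)
qed

lemma poly_max_modulus:
  assumes "\<And>t. cmod (poly p (phase t)) \<le> C" "cmod w \<le> 1"
  shows "cmod (poly p w) \<le> C"
proof (rule maximum_modulus_frontier[of "poly p" "cball 0 1"])
  fix z :: complex assume "z \<in> frontier (cball 0 1)"
  then show "cmod (poly p z) \<le> C" using assms(1) unit_circle_phase[of z] by auto
qed (use assms(2) in \<open>auto intro!: holomorphic_intros continuous_intros\<close>)

abbreviation closed_UHP :: "complex set" where "closed_UHP \<equiv> {z. 0 \<le> Im z}"

text \<open>This is the disc algebra in the variable \<open>ephase z\<close>, pulled back to the
  closed half plane. With the polynomial approximants built in, the maximum principle on the compact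
  disc replaces a growth condition at infinity.\<close>

definition hardy :: "(complex \<Rightarrow> complex) \<Rightarrow> bool"
  where "hardy g \<longleftrightarrow> (\<exists>p :: nat \<Rightarrow> complex Polynomial.poly.
    uniform_limit closed_UHP (\<lambda>n z. poly (p n) (ephase z)) g sequentially)"

lemma hardy_continuous:
  assumes "hardy g" shows "continuous_on closed_UHP g"
proof -
  obtain p :: "nat \<Rightarrow> complex Polynomial.poly"
    where p: "uniform_limit closed_UHP (\<lambda>n z. poly (p n) (ephase z)) g sequentially"
    using assms by (auto simp: hardy_def)
  have "(\<lambda>z. poly (p n) (ephase z)) holomorphic_on closed_UHP" for n
    by (intro holomorphic_intros ephase_holomorphic)
  then have "continuous_on closed_UHP (\<lambda>z. poly (p n) (ephase z))" for n
    by (rule holomorphic_on_imp_continuous_on)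
  then show ?thesis using uniform_limit_theorem[OF _ p] by simp
qed

lemma hardy_holomorphic:
  assumes "hardy g" shows "g holomorphic_on {z. 0 < Im z}"
proof -
  obtain p :: "nat \<Rightarrow> complex Polynomial.poly"
    where p: "uniform_limit closed_UHP (\<lambda>n z. poly (p n) (ephase z)) g sequentially"
    using assms by (auto simp: hardy_def)
  show ?thesis
  proof (rule holomorphic_uniform_sequence[of _ "\<lambda>n z. poly (p n) (ephase z)"])
    show op: "open {z. 0 < Im z}" by (intro open_Collect_less continuous_intros)
    show "(\<lambda>z. poly (p n) (ephase z)) holomorphic_on {z. 0 < Im z}" for n
      by (intro holomorphic_intros ephase_holomorphic)
    fix z assume "z \<in> {z. 0 < Im z}"
    then obtain d where d: "d > 0" "cball z d \<subseteq> {z. 0 < Im z}"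
      using op open_contains_cball by blast
    then have "cball z d \<subseteq> closed_UHP" by auto
    then show "\<exists>d>0. cball z d \<subseteq> {z. 0 < Im z}
        \<and> uniform_limit (cball z d) (\<lambda>n z. poly (p n) (ephase z)) g sequentially"
      using d uniform_limit_on_subset[OF p] by blast
  qed
qed

lemma hardy_linear:
  assumes "hardy g" "hardy h" shows "hardy (\<lambda>z. a * g z + b * h z)"
proof -
  obtain p q :: "nat \<Rightarrow> complex Polynomial.poly"
    where p: "uniform_limit closed_UHP (\<lambda>n z. poly (p n) (ephase z)) g sequentially"
      and q: "uniform_limit closed_UHP (\<lambda>n z. poly (q n) (ephase z)) h sequentially"
    using assms by (auto simp: hardy_def)
  have "uniform_limit closed_UHP (\<lambda>n z. poly (Polynomial.smult a (p n) + Polynomial.smult b (q n)) (ephase z))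
      (\<lambda>z. a * g z + b * h z) sequentially"
    using uniform_limit_add[OF bounded_linear.uniform_limit[OF bounded_linear_mult_right[of a] p]
        bounded_linear.uniform_limit[OF bounded_linear_mult_right[of b] q]]
    by simp
  then show ?thesis unfolding hardy_def
    by (intro exI[of _ "\<lambda>n. Polynomial.smult a (p n) + Polynomial.smult b (q n)"])
qed

lemma hardy_translate:
  assumes "hardy g" shows "hardy (\<lambda>z. g (z + of_real r))"
proof -
  obtain p :: "nat \<Rightarrow> complex Polynomial.poly"
    where p: "uniform_limit closed_UHP (\<lambda>n z. poly (p n) (ephase z)) g sequentially"
    using assms by (auto simp: hardy_def)
  have "uniform_limit closed_UHP (\<lambda>n z. poly (p n) (ephase (z + of_real r))) (\<lambda>z. g (z + of_real r)) sequentially"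
    by (rule uniform_limit_compose'[OF p]) auto
  also have "(\<lambda>n z. poly (p n) (ephase (z + of_real r))) =
      (\<lambda>n z. poly (pcompose (p n) [:0, ephase (of_real r):]) (ephase z))"
    by (simp add: poly_pcompose ephase_add)
  finally show ?thesis unfolding hardy_def
    by (intro exI[of _ "\<lambda>n. pcompose (p n) [:0, ephase (of_real r):]"])
qed

lemma hardy_bound:
  assumes g: "hardy g" and C: "\<And>t::real. cmod (g (of_real t)) \<le> C" and z: "0 \<le> Im z"
  shows "cmod (g z) \<le> C"
proof (rule field_le_epsilon)
  fix e :: real assume e: "e > 0"
  obtain p :: "nat \<Rightarrow> complex Polynomial.poly"
    where p: "uniform_limit closed_UHP (\<lambda>n z. poly (p n) (ephase z)) g sequentially"
    using g by (auto simp: hardy_def)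
  have "\<forall>\<^sub>F n in sequentially. \<forall>z\<in>closed_UHP. dist (poly (p n) (ephase z)) (g z) < e / 2"
    by (rule uniform_limitD[OF p]) (use e in simp)
  then obtain n where n: "\<And>z. 0 \<le> Im z \<Longrightarrow> dist (poly (p n) (ephase z)) (g z) < e / 2"
    by (auto simp: eventually_sequentially)
  have "cmod (poly (p n) (phase t)) \<le> C + e / 2" for t
  proof -
    have "cmod (poly (p n) (phase t)) \<le> cmod (g (of_real t)) + cmod (poly (p n) (phase t) - g (of_real t))"
      by (metis norm_triangle_sub add.commute)
    then show ?thesis using n[of "of_real t"] C[of t] by (simp add: phase_eq_ephase dist_norm)
  qed
  then have "cmod (poly (p n) (ephase z)) \<le> C + e / 2"
    by (rule poly_max_modulus) (rule norm_ephase_le_1[OF z])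
  moreover have "cmod (g z) \<le> cmod (poly (p n) (ephase z)) + dist (poly (p n) (ephase z)) (g z)"
    by (metis dist_norm norm_minus_commute norm_triangle_sub)
  ultimately show "cmod (g z) \<le> C + e" using n[OF z] by linarith
qed

text \<open>The real line corresponds to the unit circle, so the maximum principle for the
  differences \<open>p m - p n\<close> spreads the uniform Cauchy property to the whole half
  plane.\<close>

lemma hardy_extension:
  fixes p :: "nat \<Rightarrow> complex Polynomial.poly"
  assumes u: "uniform_limit UNIV (\<lambda>n t. poly (p n) (phase t)) u sequentially"
  obtains g where "hardy g" "\<And>t. g (of_real t) = u t"
proof -
  have "uniformly_Cauchy_on closed_UHP (\<lambda>n z. poly (p n) (ephase z))"
  proof (rule uniformly_Cauchy_onI)
    fix e :: real assume e: "e > 0"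
    have "uniformly_Cauchy_on UNIV (\<lambda>n t. poly (p n) (phase t))"
      by (rule uniformly_convergent_Cauchy) (use u in \<open>auto simp: uniformly_convergent_on_def\<close>)
    moreover have "e / 2 > 0" using e by simp
    ultimately obtain M
      where M: "\<And>t m n. m \<ge> M \<Longrightarrow> n \<ge> M \<Longrightarrow> dist (poly (p m) (phase t)) (poly (p n) (phase t)) < e / 2"
      unfolding uniformly_Cauchy_on_def by blast
    have "dist (poly (p m) (ephase z)) (poly (p n) (ephase z)) < e"
      if "z \<in> closed_UHP" "m \<ge> M" "n \<ge> M" for z m n
    proof -
      have "cmod (poly (p m - p n) (phase t)) \<le> e / 2" for t
        using M[OF that(2,3), of t] by (simp add: dist_norm)
      then have "cmod (poly (p m - p n) (ephase z)) \<le> e / 2"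
        by (rule poly_max_modulus) (use that in \<open>auto intro: norm_ephase_le_1\<close>)
      then show ?thesis using e by (simp add: dist_norm)
    qed
    then show "\<exists>M. \<forall>x\<in>closed_UHP. \<forall>m\<ge>M. \<forall>n\<ge>M. dist (poly (p m) (ephase x)) (poly (p n) (ephase x)) < e"
      by blast
  qed
  then obtain g where g: "uniform_limit closed_UHP (\<lambda>n z. poly (p n) (ephase z)) g sequentially"
    using Cauchy_uniformly_convergent uniformly_convergent_on_def by blast
  show thesis
  proof (rule that[of g])
    show "hardy g" using g by (auto simp: hardy_def)
    fix t
    have "(\<lambda>n. poly (p n) (ephase (of_real t))) \<longlonglongrightarrow> g (of_real t)"
      by (rule tendsto_uniform_limitI[OF g]) simp
    moreover have "(\<lambda>n. poly (p n) (phase t)) \<longlonglongrightarrow> u t"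
      by (rule tendsto_uniform_limitI[OF u]) simp
    ultimately show "g (of_real t) = u t" by (simp add: phase_eq_ephase LIMSEQ_unique)
  qed
qed

text \<open>The difference, continued by 0 below the real line, is continuous across the line and
  hence entire, and it vanishes on an open set.\<close>

lemma hardy_eq_entire:
  assumes g: "hardy g" and f: "f holomorphic_on UNIV" and eq: "\<And>t::real. f (of_real t) = g (of_real t)"
    and z: "0 < Im z"
  shows "f z = g z"
proof -
  define k where "k z = (if 0 \<le> Im z then g z - f z else 0)" for z
  have "k holomorphic_on UNIV"
  proof (rule holomorphic_on_paste_across_line[where d = \<i> and k = 0])
    have "(\<lambda>z. g z - f z) holomorphic_on {z. 0 < Im z}"
      using hardy_holomorphic[OF g] holomorphic_on_subset[OF f] by (intro holomorphic_on_diff) auto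
    then have "k holomorphic_on {z. 0 < Im z}"
      by (rule holomorphic_transform) (simp add: k_def)
    then show "k holomorphic_on UNIV \<inter> {z. 0 < \<i> \<bullet> z}" by simp
    show "k holomorphic_on UNIV \<inter> {z. \<i> \<bullet> z < 0}"
      by (rule holomorphic_transform[of "\<lambda>_. 0"]) (auto simp: k_def)
    have "continuous_on ({z. 0 \<le> Im z} \<union> {z. Im z \<le> 0}) k"
      unfolding k_def
    proof (rule continuous_on_cases)
      show "closed {z. 0 \<le> Im z}" "closed {z. Im z \<le> 0}"
        by (intro closed_Collect_le continuous_intros)+
      show "continuous_on {z. 0 \<le> Im z} (\<lambda>z. g z - f z)"
        using hardy_continuous[OF g] holomorphic_on_imp_continuous_on[OF holomorphic_on_subset[OF f]]
        by (intro continuous_on_diff) auto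
      show "\<forall>z. z \<in> {z. 0 \<le> Im z} \<and> \<not> 0 \<le> Im z \<or> z \<in> {z. Im z \<le> 0} \<and> 0 \<le> Im z \<longrightarrow> g z - f z = 0"
      proof (intro allI impI)
        fix z assume "z \<in> {z. 0 \<le> Im z} \<and> \<not> 0 \<le> Im z \<or> z \<in> {z. Im z \<le> 0} \<and> 0 \<le> Im z"
        then have "of_real (Re z) = z" by (auto simp: complex_eq_iff)
        then show "g z - f z = 0" using eq[of "Re z"] by simp
      qed
    qed simp
    moreover have "{z. 0 \<le> Im z} \<union> {z. Im z \<le> 0} = UNIV" by auto
    ultimately show "continuous_on UNIV k" by simp
  qed auto
  moreover have "k w = 0" if "w \<in> {z. Im z < 0}" for w using that by (simp add: k_def)
  ultimately have "k z = 0"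
  proof (intro analytic_continuation_open[of "{z. Im z < 0}" UNIV k "\<lambda>_. 0" z])
    show "open {z. Im z < 0}" by (intro open_Collect_less continuous_intros)
    have "- \<i> \<in> {z. Im z < 0}" by simp
    then show "{z. Im z < 0} \<noteq> {}" by blast
  qed auto
  then show ?thesis using z by (simp add: k_def)
qed

text \<open>A boundary Schwarz lemma: a function that decreases along the imaginary axis at the boundary
point \<open>0\<close> has a derivative of the corresponding sign, even if it is only differentiable along
the boundary. Uniformity makes the difference quotients converge inside the half plane as well.\<close>

lemma hardy_boundary_derivative:
  assumes v: "hardy v" and v1: "hardy v1"
    and lim: "\<And>e. e > 0 \<Longrightarrow> \<exists>d>0. \<forall>h t::real. h \<noteq> 0 \<longrightarrow> \<bar>h\<bar> < d \<longrightarrow>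
      cmod ((v (of_real t + of_real h) - v (of_real t)) / of_real h - v1 (of_real t)) \<le> e"
    and dec: "\<And>y. 0 < y \<Longrightarrow> Re (v (\<i> * of_real y)) \<le> Re (v 0)"
  shows "Re (\<i> * v1 0) \<le> 0"
proof (rule ccontr)
  assume pos: "\<not> Re (\<i> * v1 0) \<le> 0"
  have deriv: "(v has_field_derivative v1 z) (at z)" if z: "0 < Im z" for z
  proof -
    have op: "open {z. 0 < Im z}" by (intro open_Collect_less continuous_intros)
    obtain D where D: "(v has_field_derivative D) (at z)"
      using hardy_holomorphic[OF v] op z holomorphic_on_imp_differentiable_at[of v "{z. 0 < Im z}" z]
      by (auto simp: field_differentiable_def)
    have fl: "filterlim (\<lambda>h::real. complex_of_real h) (at 0) (at 0)"
      by (rule filterlim_atI) (auto intro!: tendsto_eq_intros simp: eventually_at_filter)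
    have "((\<lambda>h. (v (z + h) - v z) / h) \<longlongrightarrow> D) (at 0)" using D by (simp add: DERIV_def)
    from filterlim_compose[OF this fl]
    have t1: "((\<lambda>h::real. (v (z + of_real h) - v z) / of_real h) \<longlongrightarrow> D) (at 0)" .
    have t2: "((\<lambda>h::real. (v (z + of_real h) - v z) / of_real h) \<longlongrightarrow> v1 z) (at 0)"
    proof (rule tendstoI)
      fix e :: real assume e: "e > 0"
      from lim[of "e/2"] e obtain d where d: "d > 0" and dd: "\<And>h t::real. h \<noteq> 0 \<Longrightarrow> \<bar>h\<bar> < d \<Longrightarrow>
        cmod ((v (of_real t + of_real h) - v (of_real t)) / of_real h - v1 (of_real t)) \<le> e/2"
        by auto
      have "dist ((v (z + of_real h) - v z) / of_real h) (v1 z) < e" if h: "h \<noteq> 0" "\<bar>h\<bar> < d" for h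
      proof -
        \<comment> \<open>For fixed \<open>h\<close> the error of the difference quotient is itself
          a \<open>hardy\<close> function, so its bound on the real line persists inside the half
          plane.\<close>
        define k where "k = (\<lambda>z. (1 / of_real h) * (1 * v (z + of_real h) + (-1) * v z) + (-1) * v1 z)"
        have k: "k w = (v (w + of_real h) - v w) / of_real h - v1 w" for w
          using h by (simp add: k_def field_simps)
        have "hardy k" unfolding k_def by (intro hardy_linear hardy_translate v v1)
        then have "cmod (k z) \<le> e / 2"
          by (rule hardy_bound) (use dd[OF h] z in \<open>auto simp: k\<close>)
        then show ?thesis using e by (simp add: k dist_norm)
      qed
      then show "\<forall>\<^sub>F h in at 0. dist ((v (z + of_real h) - v z) / of_real h) (v1 z) < e"
        unfolding eventually_at using d by (auto simp: dist_norm)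
    qed
    have "D = v1 z" by (rule tendsto_unique[OF _ t1 t2]) simp
    then show ?thesis using D by simp
  qed
  have "continuous_on closed_UHP (\<lambda>z. Re (\<i> * v1 z))"
    by (intro continuous_intros hardy_continuous v1)
  then have "continuous (at 0 within closed_UHP) (\<lambda>z. Re (\<i> * v1 z))"
    by (simp add: continuous_on_eq_continuous_within)
  then obtain d where d: "d > 0" and dd: "\<And>z. 0 \<le> Im z \<Longrightarrow> dist z 0 < d \<Longrightarrow> dist (Re (\<i> * v1 z)) (Re (\<i> * v1 0)) < Re (\<i> * v1 0)"
    using pos unfolding continuous_within_eps_delta by (metis (no_types, lifting) mem_Collect_eq not_le)
  \<comment> \<open>The derivative of \<open>f\<close> at \<open>s > 0\<close> is
    \<open>Re (\<i> * v1 (\<i> * s))\<close>, which is positive near 0 by continuity. The mean value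
    theorem asks for derivatives at interior points and for mere continuity at 0.\<close>
  define f where "f s = Re (v (\<i> * of_real s))" for s :: real
  have df: "(f has_real_derivative Re (\<i> * v1 (\<i> * of_real s))) (at s)" if "0 < s" for s
  proof -
    have "((\<lambda>s. \<i> * complex_of_real s) has_vector_derivative \<i> * of_real 1) (at s)"
      by (intro has_vector_derivative_mult_right has_vector_derivative_of_real DERIV_ident)
    moreover have "(v has_field_derivative v1 (\<i> * of_real s)) (at (\<i> * of_real s))"
      using that by (intro deriv) simp
    ultimately have "(v \<circ> (\<lambda>s. \<i> * of_real s) has_vector_derivative \<i> * of_real 1 * v1 (\<i> * of_real s)) (at s)"
      by (rule field_vector_diff_chain_at)
    from bounded_linear.has_vector_derivative[OF bounded_linear_Re this] show ?thesis
      by (simp add: o_def f_def[abs_def] has_real_derivative_iff_has_vector_derivative)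
  qed
  have "\<exists>l s. 0 < s \<and> s < d / 2 \<and> (f has_real_derivative l) (at s) \<and> f (d/2) - f 0 = (d/2 - 0) * l"
  proof (rule MVT)
    show "continuous_on {0..d/2} f"
      unfolding f_def
      by (intro continuous_intros continuous_on_compose2[OF hardy_continuous[OF v]]) auto
    show "f differentiable (at s)" if "0 < s" "s < d/2" for s
      using df[OF that(1)] real_differentiable_def by blast
  qed (use d in auto)
  then obtain l s where s: "0 < s" "s < d / 2" and l: "(f has_real_derivative l) (at s)" "f (d/2) - f 0 = (d/2) * l"
    by auto
  have "l = Re (\<i> * v1 (\<i> * of_real s))"
    using l(1) df[OF s(1)] by (rule DERIV_unique)
  moreover have "Re (\<i> * v1 (\<i> * of_real s)) > 0"
    using dd[of "\<i> * of_real s"] s by (auto simp: norm_mult dist_real_def)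
  moreover have "f (d/2) \<le> f 0" using dec[of "d/2"] d by (simp add: f_def)
  ultimately show False using l(2) d by (smt (verit) half_gt_zero mult_pos_pos)
qed

section \<open>Ground states\<close>

lemma phase_power: "phase t ^ n = phase (real n * t)"
  by (induction n) (simp_all add: phase_add distrib_right)

lemma scaleC_diff_left: "(a - b) *\<^sub>C (x::'a::cstar_algebra) = a *\<^sub>C x - b *\<^sub>C x"
  using scaleC_add_left[of a "- b" x] by (simp add: scaleC_minus_left)

lemma tendsto_scaleC:
  fixes f :: "'b \<Rightarrow> 'a::cstar_algebra"
  assumes a: "(a \<longlongrightarrow> b) F" and f: "(f \<longlongrightarrow> x) F" shows "((\<lambda>i. a i *\<^sub>C f i) \<longlongrightarrow> b *\<^sub>C x) F"
proof -
  have "bounded_bilinear (scaleC :: complex \<Rightarrow> 'a \<Rightarrow> 'a)"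
    by (rule bounded_bilinear.intro)
       (auto simp: scaleC_add_left scaleC_add_right scaleR_scaleC scaleC_scaleC scaleR_conv_of_real
          mult.commute norm_scaleC intro!: exI[of _ 1])
  then show ?thesis using a f by (rule bounded_bilinear.tendsto)
qed

lemma bounded_linear_scaleC_left: "bounded_linear (\<lambda>a. a *\<^sub>C (x::'a::cstar_algebra))"
  by (rule bounded_linear_intro[where K = "norm x"])
     (simp_all add: scaleC_add_left norm_scaleC scaleR_scaleC scaleC_scaleC scaleR_conv_of_real)

text \<open>The weights treat the three actions at once: \<alpha> has weight 1 below
  \<open>N\<close> and 0 elsewhere, \<beta> the reverse, and \<gamma> has weight 1
  throughout.\<close>

locale vacuum_state = OA_inf_algebra N A S + dynamical_state \<phi> \<sigma>
  for N A and S :: "nat \<Rightarrow> 'a::cstar_algebra" and \<phi> \<sigma> +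
  fixes w :: "nat \<Rightarrow> nat"
  assumes vacuum: "\<not> (\<mu> = [] \<and> \<nu> = []) \<Longrightarrow> \<phi> (W \<mu> * star (W \<nu>)) = 0"
    and weight: "\<sigma> t (S j) = phase (real (w j) * t) *\<^sub>C S j"
begin

lemma word_orbit: "\<sigma> t (W \<mu>) = phase (real (sum_list (map w \<mu>)) * t) *\<^sub>C W \<mu>"
  by (induction \<mu>)
     (simp_all add: word_prod_Cons action.one scaleC_one action.mult weight mult_scaleC_left
        mult_scaleC_right scaleC_scaleC distrib_right phase_add, simp add: mult.commute)

lemma compression_vacuum:
  assumes "x \<in> word_span S" "\<nu> \<noteq> []"
  shows "\<phi> (W \<nu> * x * star (W \<nu>)) = 0"
  using assms(1)
proof (induction rule: word_span.induct)
  case (word \<kappa> \<rho>)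
  have "W \<nu> * (W \<kappa> * star (W \<rho>)) * star (W \<nu>) = W (\<nu> @ \<kappa>) * star (W (\<nu> @ \<rho>))"
    by (simp add: word_prod_append star_mult mult.assoc)
  then show ?case using vacuum[of "\<nu> @ \<kappa>" "\<nu> @ \<rho>"] assms(2) by simp
qed (simp_all add: distrib_left distrib_right mult_scaleC_left mult_scaleC_right add scaleC)

text \<open>In the GNS picture \<open>W \<mu> * star (W \<nu>)\<close> kills the vacuum vector: its
  squared length is \<phi> of \<open>star (W \<mu>) * W \<mu>\<close> compressed by
  \<open>W \<nu>\<close>, a combination of words that all begin with \<nu>.\<close>

lemma annihilates_vacuum:
  assumes "\<nu> \<noteq> []" shows "\<phi> (y * (W \<mu> * star (W \<nu>))) = 0"
proof -
  let ?v = "W \<mu> * star (W \<nu>)"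
  have "star (W \<mu>) * W \<mu> \<in> word_span S"
    using star_alg_gen_mult_word_span(2)[OF word_prod_gen word_span.word[of S \<mu> "[]"]] by simp
  from compression_vacuum[OF this assms] have "\<phi> (star ?v * ?v) = 0"
    by (simp add: star_mult star_star mult.assoc)
  then show ?thesis using Cauchy_Schwarz[of "star y" ?v] by (simp add: star_star)
qed

lemma word_orbit_form:
  "\<phi> (y * \<sigma> t (W \<mu> * star (W \<nu>)))
    = (if \<nu> = [] then phase t ^ sum_list (map w \<mu>) * \<phi> (y * W \<mu>) else 0)"
  by (simp add: action.mult action.star action.one word_orbit star_scaleC mult_scaleC_left
      mult_scaleC_right scaleC phase_power annihilates_vacuum)

text \<open>Only words with empty \<nu> contribute, each with the nonnegative frequency given by its
  total weight. If all weights are positive, frequency 0 belongs to the empty word alone, so the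
  constant term is the component along the vacuum.\<close>

lemma orbit_polynomial:
  assumes "x \<in> word_span S"
  shows "\<exists>p. (\<forall>t. \<phi> (y * \<sigma> t x) = poly p (phase t)) \<and>
    ((\<forall>j. w j > 0) \<longrightarrow> Polynomial.coeff p 0 = \<phi> y * \<phi> x)"
  using assms
proof (induction rule: word_span.induct)
  case (word \<mu> \<nu>)
  show ?case
  proof (cases "\<nu> = []")
    case True
    have "\<phi> (W \<mu>) = 0 \<and> (\<exists>n\<in>set \<mu>. w n \<noteq> 0)" if "\<mu> \<noteq> []" "\<forall>j. w j > 0"
      using vacuum[of \<mu> "[]"] that by (cases \<mu>) auto
    then have "(\<forall>j. w j > 0) \<Longrightarrow> Polynomial.coeff (Polynomial.monom (\<phi> (y * W \<mu>)) (sum_list (map w \<mu>))) 0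
        = \<phi> y * \<phi> (W \<mu> * star (W \<nu>))"
      using True by (cases "\<mu> = []") (fastforce simp: one)+
    moreover have "\<phi> (y * \<sigma> t (W \<mu> * star (W \<nu>)))
        = poly (Polynomial.monom (\<phi> (y * W \<mu>)) (sum_list (map w \<mu>))) (phase t)" for t
      unfolding word_orbit_form using True by (simp add: poly_monom)
    ultimately show ?thesis by blast
  next
    case False
    then show ?thesis
      using vacuum[of \<mu> \<nu>] by (intro exI[of _ 0]) (simp add: word_orbit_form)
  qed
next
  case (add x x')
  then obtain p p' where
    "\<And>t. \<phi> (y * \<sigma> t x) = poly p (phase t)" "(\<forall>j. w j > 0) \<Longrightarrow> Polynomial.coeff p 0 = \<phi> y * \<phi> x"
    "\<And>t. \<phi> (y * \<sigma> t x') = poly p' (phase t)" "(\<forall>j. w j > 0) \<Longrightarrow> Polynomial.coeff p' 0 = \<phi> y * \<phi> x'"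
    by blast
  then show ?case
    by (intro exI[of _ "p + p'"]) (simp add: action.add distrib_left state_on.add[OF state_on_axioms])
next
  case (scale x a)
  then obtain p where
    "\<And>t. \<phi> (y * \<sigma> t x) = poly p (phase t)" "(\<forall>j. w j > 0) \<Longrightarrow> Polynomial.coeff p 0 = \<phi> y * \<phi> x"
    by blast
  then show ?case
    by (intro exI[of _ "Polynomial.smult a p"]) (simp add: action.scaleC mult_scaleC_right scaleC)
qed

lemma orbit_form_uniform_limit:
  assumes "f \<longlonglongrightarrow> x"
  shows "uniform_limit UNIV (\<lambda>n t. \<phi> (y * \<sigma> t (f n))) (\<lambda>t. \<phi> (y * \<sigma> t x)) sequentially"
proof (rule uniform_limitI)
  fix e :: real assume e: "e > 0"
  have "(\<lambda>n. norm y * norm (f n - x)) \<longlonglongrightarrow> norm y * 0"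
    using assms by (intro tendsto_intros) (simp add: LIM_zero_iff tendsto_norm_zero_iff)
  then have "\<forall>\<^sub>F n in sequentially. norm y * norm (f n - x) < e"
    using e by (intro order_tendstoD(2)) auto
  then show "\<forall>\<^sub>F n in sequentially. \<forall>t\<in>UNIV. dist (\<phi> (y * \<sigma> t (f n))) (\<phi> (y * \<sigma> t x)) < e"
  proof (rule eventually_mono)
    fix n assume n: "norm y * norm (f n - x) < e"
    have "\<phi> (y * \<sigma> t (f n)) - \<phi> (y * \<sigma> t x) = \<phi> (y * \<sigma> t (f n - x))" for t
      by (simp add: action.diff right_diff_distrib diff)
    then show "\<forall>t\<in>UNIV. dist (\<phi> (y * \<sigma> t (f n))) (\<phi> (y * \<sigma> t x)) < e"
      using comp_form_bound[of y _ "f n - x"] n by (auto simp: dist_norm intro: le_less_trans)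
  qed
qed

lemma orbit_hardy:
  obtains g where "hardy g" "\<And>t. g (of_real t) = \<phi> (y * \<sigma> t x)"
proof -
  obtain f where f: "\<And>n. f n \<in> word_span S" "f \<longlonglongrightarrow> x" using word_span_approx[of x] by blast
  have "\<forall>n. \<exists>p. \<forall>t. \<phi> (y * \<sigma> t (f n)) = poly p (phase t)" using orbit_polynomial[OF f(1)] by blast
  then obtain p where p: "\<And>n t. \<phi> (y * \<sigma> t (f n)) = poly (p n) (phase t)" by metis
  show thesis
    using hardy_extension[OF orbit_form_uniform_limit[OF f(2), of y, unfolded p]] that by blast
qed

text \<open>If all generators have positive weight, the frequencies that occur in the orbit of a vector
orthogonal to the vacuum are at least \<open>1\<close>.\<close>

lemma orbit_hardy_positive_weight:
  assumes w: "\<forall>j. w j > 0" and x: "\<phi> x = 0"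
  obtains g where "hardy g" "\<And>t. g (of_real t) = phase (- t) * \<phi> (y * \<sigma> t x)"
proof -
  obtain f where f: "\<And>n. f n \<in> word_span S" "f \<longlonglongrightarrow> x" using word_span_approx[of x] by blast
  \<comment> \<open>Removing the vacuum component puts the approximants into the kernel of \<phi>,
    so every orbit polynomial is divisible by its variable.\<close>
  define f' where "f' n = f n - \<phi> (f n) *\<^sub>C 1" for n
  have f': "f' n \<in> word_span S" "\<phi> (f' n) = 0" for n
    by (auto simp: f'_def diff scaleC one intro!: word_span_diff f word_span.scale word_span_one)
  have "(\<lambda>n. \<phi> (f n) *\<^sub>C (1::'a)) \<longlonglongrightarrow> \<phi> x *\<^sub>C 1"
    by (intro bounded_linear.tendsto[OF bounded_linear_scaleC_left] tendsto f)
  from tendsto_diff[OF f(2) this] have lim: "f' \<longlonglongrightarrow> x" by (simp add: f'_def[abs_def] x)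
  have "\<forall>n. \<exists>p. \<forall>t. \<phi> (y * \<sigma> t (f' n)) = phase t * poly p (phase t)"
  proof
    fix n
    obtain p where p: "\<And>t. \<phi> (y * \<sigma> t (f' n)) = poly p (phase t)" "Polynomial.coeff p 0 = 0"
      using orbit_polynomial[OF f'(1)[of n], of y] w f'(2) by auto
    obtain q where "p = pCons 0 q" using p(2) by (metis pCons_cases coeff_pCons_0)
    then show "\<exists>p. \<forall>t. \<phi> (y * \<sigma> t (f' n)) = phase t * poly p (phase t)" using p(1) by auto
  qed
  then obtain p where p: "\<And>n t. \<phi> (y * \<sigma> t (f' n)) = phase t * poly (p n) (phase t)" by metis
  have "uniform_limit UNIV (\<lambda>n t. poly (p n) (phase t)) (\<lambda>t. phase (- t) * \<phi> (y * \<sigma> t x)) sequentially"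
  proof (rule uniform_limitI)
    fix e :: real assume "e > 0"
    from uniform_limitD[OF orbit_form_uniform_limit[OF lim, of y] this]
    show "\<forall>\<^sub>F n in sequentially. \<forall>t\<in>UNIV. dist (poly (p n) (phase t)) (phase (- t) * \<phi> (y * \<sigma> t x)) < e"
    proof (rule eventually_mono, intro ballI)
      fix n t assume "\<forall>t\<in>UNIV. dist (\<phi> (y * \<sigma> t (f' n))) (\<phi> (y * \<sigma> t x)) < e"
      then have "cmod (phase (- t) * (phase t * poly (p n) (phase t) - \<phi> (y * \<sigma> t x))) < e"
        by (simp add: norm_mult dist_norm p)
      then show "dist (poly (p n) (phase t)) (phase (- t) * \<phi> (y * \<sigma> t x)) < e"
        by (simp add: dist_norm right_diff_distrib flip: mult.assoc)
    qed
  qed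
  from hardy_extension[OF this] show thesis using that by blast
qed

lemma ground_bound:
  assumes F: "entire_orbit B \<sigma> x F" and z: "0 < Im z"
  shows "cmod (\<phi> (y * F z)) \<le> norm x * norm y"
proof -
  obtain g where g: "hardy g" "\<And>t. g (of_real t) = \<phi> (y * \<sigma> t x)" using orbit_hardy[of y x] by blast
  have bl: "bounded_linear (\<lambda>a. \<phi> (y * a))"
    using bounded_linear_compose[OF bounded_linear bounded_linear_mult_right] by (simp add: o_def)
  have "(\<lambda>z. \<phi> (y * F z)) holomorphic_on UNIV"
  proof (rule holomorphic_onI)
    fix z
    obtain D where "(F has_derivative (\<lambda>h. h *\<^sub>C D)) (at z)"
      using F unfolding entire_orbit_def by blast
    from bounded_linear.has_derivative[OF bl this]
    have "((\<lambda>z. \<phi> (y * F z)) has_derivative (\<lambda>h. \<phi> (y * D) * h)) (at z)"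
      by (simp add: mult_scaleC_right scaleC mult.commute)
    then have "((\<lambda>z. \<phi> (y * F z)) has_field_derivative \<phi> (y * D)) (at z)"
      by (simp add: has_field_derivative_def)
    then show "(\<lambda>z. \<phi> (y * F z)) field_differentiable (at z within UNIV)"
      by (auto simp: field_differentiable_def)
  qed
  then have "\<phi> (y * F z) = g z"
    by (rule hardy_eq_entire[OF g(1) _ _ z]) (use F g(2) in \<open>simp add: entire_orbit_def\<close>)
  moreover have "cmod (g z) \<le> norm y * norm x"
    by (rule hardy_bound[OF g(1)]) (use comp_form_bound g(2) z in auto)
  ultimately show ?thesis by (simp add: mult.commute)
qed

lemma P_fixed: "\<sigma> t P = P"
proof -
  have "\<sigma> t (S j * star (S j)) = S j * star (S j)" for j
    by (simp add: action.mult action.star weight star_scaleC mult_scaleC_left mult_scaleC_right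
        scaleC_scaleC cnj_phase scaleC_one)
  then show ?thesis by (simp add: P_proj_def action.diff action.one action.sum)
qed

lemma vacuum_P: "\<phi> P = 1"
  using vacuum[of "[j]" "[j]" for j] by (simp add: P_proj_def diff one sum word_prod_Cons)

lemma corner_ground_state: "ground_state (corner P) P \<sigma> \<phi>"
  unfolding ground_state_def
  using action.restrict_corner[OF P_idem P_fixed] ground_bound
  by (auto simp: state_def add scaleC Im_pos Re_pos vacuum_P)

section \<open>The generator and the spectral gap\<close>

lemma invariant: "\<phi> (\<sigma> t x) = \<phi> x"
proof -
  have eq: "\<phi> (\<sigma> t y) = \<phi> y" if "y \<in> word_span S" for y
    using that
  proof (induction rule: word_span.induct)
    case (word \<mu> \<nu>)
    show ?case
      using vacuum[of \<mu> \<nu>] vacuum[of \<mu> "[]"] word_orbit_form[of 1 t \<mu> \<nu>]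
      by (cases "\<mu> = []"; cases "\<nu> = []") (auto simp: action.one)
  qed (simp_all add: action.add action.scaleC state_on.add[OF state_on_axioms] scaleC)
  obtain f where f: "\<And>n. f n \<in> word_span S" "f \<longlonglongrightarrow> x" using word_span_approx[of x] by blast
  have "(\<lambda>n. \<phi> (f n)) \<longlonglongrightarrow> \<phi> (\<sigma> t x)"
    using comp.tendsto[OF f(2), of t] by (simp add: eq f(1))
  then show ?thesis using tendsto[OF f(2)] LIMSEQ_unique by blast
qed

text \<open>Cauchy-Schwarz and invariance bound the orbit by its value at \<open>t = 0\<close>,
  which is sharper than the bound by norms. The boundary derivative argument compares with exactly
  this value.\<close>

lemma orbit_form_le: "cmod (\<phi> (star x * \<sigma> t x)) \<le> Re (\<phi> (star x * x))"
proof -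
  have "(cmod (\<phi> (star x * \<sigma> t x)))\<^sup>2 \<le> Re (\<phi> (star x * x)) * Re (\<phi> (\<sigma> t (star x * x)))"
    using Cauchy_Schwarz[of x "\<sigma> t x"] by (simp add: action.mult action.star)
  then have "(cmod (\<phi> (star x * \<sigma> t x)))\<^sup>2 \<le> (Re (\<phi> (star x * x)))\<^sup>2"
    by (simp add: invariant power2_eq_square)
  then show ?thesis by (rule power2_le_imp_le) (rule Re_pos)
qed

text \<open>The real part of the form along the orbit is maximal at \<open>t = 0\<close>, so its
  derivative vanishes there. This is the reality of \<open>- \<i> * \<phi> (star x * d)\<close> that
  a spectral gap includes.\<close>

lemma generator_form_real_part:
  assumes D: "has_generator \<sigma> x d"
  shows "Re (\<phi> (star x * d)) = 0"
proof -
  let ?f = "\<lambda>t. Re (\<phi> (star x * \<sigma> t x))"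
  have bl: "bounded_linear (\<lambda>a. Re (\<phi> (star x * a)))"
    using bounded_linear_compose[OF bounded_linear_Re
        bounded_linear_compose[OF bounded_linear bounded_linear_mult_right]] by (simp add: o_def)
  have "((\<lambda>t. (?f t - ?f 0) / t) \<longlongrightarrow> Re (\<phi> (star x * d))) (at 0)"
    using bounded_linear.tendsto[OF bl D[unfolded has_generator_def]]
    by (simp add: scaleR right_diff_distrib diff action.at_0 diff_divide_distrib)
  then have "(?f has_real_derivative Re (\<phi> (star x * d))) (at 0)"
    by (simp add: DERIV_def diff_divide_distrib action.at_0)
  moreover have "?f y \<le> ?f 0" for y
    using orbit_form_le[of x y] complex_Re_le_cmod[of "\<phi> (star x * \<sigma> y x)"]
    by (simp add: action.at_0)
  ultimately show ?thesis by (intro DERIV_local_max[of ?f _ 0 1]) auto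
qed

text \<open>Allows one frequency to be split off from the orbit of \<open>d\<close> as well as from
  that of \<open>x\<close>.\<close>

lemma generator_vacuum:
  assumes D: "has_generator \<sigma> x d"
  shows "\<phi> d = 0"
proof -
  have "((\<lambda>t. \<phi> ((1 / t) *\<^sub>R (\<sigma> t x - x))) \<longlongrightarrow> \<phi> d) (at 0)"
    using tendsto[OF D[unfolded has_generator_def]] .
  moreover have "(\<lambda>t. \<phi> ((1 / t) *\<^sub>R (\<sigma> t x - x))) = (\<lambda>t. 0)"
    by (simp add: scaleR diff invariant)
  ultimately show ?thesis by (metis tendsto_const tendsto_unique trivial_limit_at)
qed

text \<open>After one frequency is split off, the orbit form still extends to a \<open>hardy\<close>
  function \<open>v\<close> whose modulus is at most \<open>v 0\<close>. Its boundary derivative at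
  0 is the form at \<open>d\<close> minus \<open>2 * pi * \<i>\<close> times the form at
  \<open>x\<close>, and the boundary lemma fixes its sign.\<close>

lemma generator_form_ge:
  assumes w: "\<forall>j. w j > 0" and x: "\<phi> x = 0" and D: "has_generator \<sigma> x d"
  shows "2 * pi * Re (\<phi> (star x * x)) \<le> Im (\<phi> (star x * d))"
proof -
  obtain v where v: "hardy v" "\<And>t. v (of_real t) = phase (- t) * \<phi> (star x * \<sigma> t x)"
    using orbit_hardy_positive_weight[OF w x] by blast
  obtain k where k: "hardy k" "\<And>t. k (of_real t) = phase (- t) * \<phi> (star x * \<sigma> t d)"
    using orbit_hardy_positive_weight[OF w generator_vacuum[OF D]] by blast
  \<comment> \<open>\<open>d1\<close> is the derivative at 0 of
    \<open>phase (- t) *\<^sub>C \<sigma> t x\<close>, and \<open>v1\<close> extends the derivative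
    of \<open>v\<close> along the real line.\<close>
  define v1 where "v1 = (\<lambda>z. 1 * k z + (- 2 * of_real pi * \<i>) * v z)"
  define d1 where "d1 = d + (- 2 * of_real pi * \<i>) *\<^sub>C x"
  have v1: "v1 (of_real t) = phase (- t) * \<phi> (star x * \<sigma> t d1)" for t
    by (simp add: v1_def v k d1_def action.add action.scaleC add scaleC mult_scaleC_right algebra_simps)
  let ?Q = "\<lambda>h::real. (1 / h) *\<^sub>R (phase (- h) *\<^sub>C \<sigma> h x - x)"
  have Q: "(?Q \<longlongrightarrow> d1) (at 0)"
  proof -
    have "((\<lambda>z. ephase (- z)) has_field_derivative (- 2 * of_real pi * \<i>)) (at 0)"
      unfolding ephase_def by (auto intro!: derivative_eq_intros)
    then have "((\<lambda>h. (ephase (- h) - 1) / h) \<longlongrightarrow> - 2 * of_real pi * \<i>) (at 0)"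
      by (simp add: DERIV_def ephase_def)
    moreover have "filterlim (\<lambda>h::real. complex_of_real h) (at 0) (at 0)"
      by (rule filterlim_atI) (auto intro!: tendsto_eq_intros simp: eventually_at_filter)
    ultimately have "((\<lambda>h::real. (ephase (- of_real h) - 1) / of_real h) \<longlongrightarrow> - 2 * of_real pi * \<i>) (at 0)"
      by (rule filterlim_compose)
    then have p: "((\<lambda>h::real. (phase (- h) - 1) / of_real h) \<longlongrightarrow> - 2 * of_real pi * \<i>) (at 0)"
      by (simp add: phase_eq_ephase)
    have "?Q h = phase (- h) *\<^sub>C ((1 / h) *\<^sub>R (\<sigma> h x - x)) + ((phase (- h) - 1) / of_real h) *\<^sub>C x" for h
      by (simp add: scaleR_scaleC scaleC_scaleC scaleC_diff_right diff_divide_distrib scaleC_diff_left)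
    moreover have "((\<lambda>h. phase (- h) *\<^sub>C ((1 / h) *\<^sub>R (\<sigma> h x - x)) + ((phase (- h) - 1) / of_real h) *\<^sub>C x)
        \<longlongrightarrow> 1 *\<^sub>C d + (- 2 * of_real pi * \<i>) *\<^sub>C x) (at 0)"
    proof (intro tendsto_add tendsto_scaleC)
      have "isCont (\<lambda>h::real. phase (- h)) 0" unfolding phase_def by (intro continuous_intros)
      then show "((\<lambda>h::real. phase (- h)) \<longlongrightarrow> 1) (at 0)" by (simp add: isCont_def)
    qed (use p D in \<open>auto simp: has_generator_def\<close>)
    ultimately show ?thesis by (simp add: d1_def scaleC_one)
  qed
  have "Re (\<i> * v1 0) \<le> 0"
  proof (rule hardy_boundary_derivative[OF v(1)])
    show "hardy v1" unfolding v1_def by (intro hardy_linear k v)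
  next
    fix e :: real assume e: "e > 0"
    have "((\<lambda>h. norm x * norm (?Q h - d1)) \<longlongrightarrow> norm x * 0) (at 0)"
      using Q by (intro tendsto_intros) (simp add: LIM_zero_iff tendsto_norm_zero_iff)
    then have "\<forall>\<^sub>F h in at 0. norm x * norm (?Q h - d1) < e"
      using e by (intro order_tendstoD(2)) auto
    then obtain r where r: "r > 0" "\<And>h. h \<noteq> 0 \<Longrightarrow> \<bar>h\<bar> < r \<Longrightarrow> norm x * norm (?Q h - d1) < e"
      by (auto simp: eventually_at dist_real_def)
    have "cmod ((v (of_real t + of_real h) - v (of_real t)) / of_real h - v1 (of_real t)) \<le> e"
      if h: "h \<noteq> 0" "\<bar>h\<bar> < r" for h t
    proof -
      \<comment> \<open>Up to a phase, the error at \<open>t\<close> comes from \<sigma> at time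
        \<open>t\<close> applied to the error at 0, so the estimate does not depend on
        \<open>t\<close>.\<close>
      have "v (of_real t + of_real h) = phase (- t) * \<phi> (star x * \<sigma> t (phase (- h) *\<^sub>C \<sigma> h x))"
        using v(2)[of "t + h"]
        using phase_add[of "- t" "- h"]
        by (simp add: action.flow action.scaleC mult_scaleC_right scaleC)
      then have "(v (of_real t + of_real h) - v (of_real t)) / of_real h - v1 (of_real t)
          = phase (- t) * \<phi> (star x * \<sigma> t (?Q h - d1))"
        by (simp only: v v1 action.diff action.scaleR right_diff_distrib diff scaleR mult_scaleR_right)
           (simp add: scaleR_conv_of_real algebra_simps diff_divide_distrib)
      then show ?thesis
        using comp_form_bound[of "star x" t "?Q h - d1"] r(2)[OF h] by (simp add: norm_mult norm_star)
    qed
    then show "\<exists>r>0. \<forall>h t::real. h \<noteq> 0 \<longrightarrow> \<bar>h\<bar> < r \<longrightarrow>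
      cmod ((v (of_real t + of_real h) - v (of_real t)) / of_real h - v1 (of_real t)) \<le> e"
      using r(1) by blast
  next
    fix y :: real assume y: "0 < y"
    have "cmod (v (\<i> * of_real y)) \<le> Re (\<phi> (star x * x))"
      by (rule hardy_bound[OF v(1)]) (use y orbit_form_le in \<open>auto simp: v norm_mult\<close>)
    then show "Re (v (\<i> * of_real y)) \<le> Re (v 0)"
      using v(2)[of 0] complex_Re_le_cmod[of "v (\<i> * of_real y)"] by (simp add: action.at_0)
  qed
  moreover have "v1 0 = \<phi> (star x * d) - 2 * of_real pi * \<i> * \<phi> (star x * x)"
    using v1[of 0] by (simp add: action.at_0 d1_def distrib_left add mult_scaleC_right scaleC)
  ultimately show ?thesis by simp
qed

lemma corner_spectral_gap:
  assumes w: "\<forall>j. w j > 0"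
  shows "spectral_gap (corner P) P \<sigma> \<phi> (2 * pi)"
  unfolding spectral_gap_def
  using corner_ground_state generator_form_ge[OF w] generator_form_real_part by auto

end

lemma spectral_gap_mono:
  "spectral_gap B e \<sigma> \<phi> g \<Longrightarrow> 0 < g' \<Longrightarrow> g' \<le> g \<Longrightarrow> (\<And>x. x \<in> B \<Longrightarrow> 0 \<le> Re (\<phi> (star x * x)))
    \<Longrightarrow> spectral_gap B e \<sigma> \<phi> g'"
  unfolding spectral_gap_def by (meson mult_right_mono order_trans)

section \<open>Uniqueness of the ground state for the gauge action on the corner\<close>

locale gauge_action = OA_inf_algebra N A S + action_on \<sigma>
  for N A and S :: "nat \<Rightarrow> 'a::cstar_algebra" and \<sigma> +
  assumes gauge: "\<sigma> t (S j) = phase t *\<^sub>C S j"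
begin

lemma gauge_word: "\<sigma> t (W \<mu>) = phase (real (length \<mu>) * t) *\<^sub>C W \<mu>"
  by (induction \<mu>)
     (simp_all add: word_prod_Cons one scaleC_one mult gauge mult_scaleC_left
        mult_scaleC_right scaleC_scaleC distrib_right phase_add, simp add: mult.commute)

lemma gauge_word_pair:
  "\<sigma> t (W \<mu> * star (W \<nu>)) = phase ((real (length \<mu>) - real (length \<nu>)) * t) *\<^sub>C (W \<mu> * star (W \<nu>))"
  using phase_add[of "real (length \<mu>) * t" "- (real (length \<nu>) * t)"]
  by (simp add: mult star gauge_word star_scaleC mult_scaleC_left mult_scaleC_right scaleC_scaleC
      cnj_phase left_diff_distrib) (simp add: mult.commute)

lemma gauge_P: "\<sigma> t P = P"
proof -
  have "\<sigma> t (S j * star (S j)) = S j * star (S j)" for j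
    using gauge_word_pair[of t "[j]" "[j]"] by (simp add: word_prod_Cons scaleC_one)
  then show ?thesis by (simp add: P_proj_def diff one sum)
qed

lemma P_word: "\<mu> \<noteq> [] \<Longrightarrow> P * W \<mu> = (if hd \<mu> < N then 0 else W \<mu>)"
  by (cases \<mu>) (simp_all add: word_prod_Cons P_S flip: mult.assoc)

end

locale gauge_ground_state = gauge_action N A S \<sigma>
  for N A and S :: "nat \<Rightarrow> 'a::cstar_algebra" and \<sigma> +
  fixes \<psi> :: "'a \<Rightarrow> complex"
  assumes ground: "ground_state (corner P) P \<sigma> \<psi>"
begin

lemma corner_state: "state (corner P) P \<psi>"
  using ground by (simp add: ground_state_def)

lemma \<psi>_add: "x \<in> corner P \<Longrightarrow> y \<in> corner P \<Longrightarrow> \<psi> (x + y) = \<psi> x + \<psi> y"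
  and \<psi>_scaleC: "x \<in> corner P \<Longrightarrow> \<psi> (a *\<^sub>C x) = a * \<psi> x"
  and \<psi>_P: "\<psi> P = 1"
  using corner_state by (simp_all add: state_def)

lemma corner_zero: "0 \<in> corner P"
  using corner_P_closed(2)[OF corner_P_closed(5), of 0] by simp

lemma corner_diff: "x \<in> corner P \<Longrightarrow> y \<in> corner P \<Longrightarrow> x - y \<in> corner P"
  using corner_P_closed(1)[of x "- y"] corner_P_closed(2)[of y "-1"] by (simp add: scaleC_minus_one)

lemma \<psi>_diff: "x \<in> corner P \<Longrightarrow> y \<in> corner P \<Longrightarrow> \<psi> (x - y) = \<psi> x - \<psi> y"
  using \<psi>_add[of x "- y"] \<psi>_scaleC[of y "-1"] corner_P_closed(2)[of y "-1"]
  by (simp add: scaleC_minus_one)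

lemma \<psi>_0: "\<psi> 0 = 0"
  using \<psi>_scaleC[OF corner_zero, of 0] by simp

lemma \<psi>_sum: "(\<And>i. i \<in> I \<Longrightarrow> f i \<in> corner P) \<Longrightarrow> \<psi> (sum f I) = (\<Sum>i\<in>I. \<psi> (f i)) \<and> sum f I \<in> corner P"
  by (induction I rule: infinite_finite_induct) (auto simp: \<psi>_0 corner_zero \<psi>_add corner_P_closed)

lemma \<psi>_star:
  assumes "x \<in> corner P" shows "\<psi> (star x) = cnj (\<psi> x)"
proof -
  have "\<psi> (star x * P) = cnj (\<psi> (star P * x))"
    by (rule state_hermitian[OF corner_state]) (use assms corner_P_closed in auto)
  then show ?thesis using assms corner_P_unit corner_P_closed(4) by (simp add: P_selfadjoint)
qed

lemma ground_bound:
  "x \<in> corner P \<Longrightarrow> y \<in> corner P \<Longrightarrow> entire_orbit (corner P) \<sigma> x F \<Longrightarrow> 0 < Im z \<Longrightarrow>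
    cmod (\<psi> (y * F z)) \<le> norm x * norm y"
  using ground by (auto simp: ground_state_def)

text \<open>The ground state inequality for the fixed element \<open>P\<close>, whose entire orbit
  is constant, already contains the norm bound.\<close>

lemma \<psi>_bound:
  assumes "x \<in> corner P" shows "cmod (\<psi> x) \<le> norm x"
proof -
  have "entire_orbit (corner P) \<sigma> P (\<lambda>z. P)"
    by (auto simp: entire_orbit_def gauge_P corner_P_closed intro!: exI[of _ 0])
  from ground_bound[OF corner_P_closed(5) assms this, of \<i>]
  have "cmod (\<psi> x) \<le> norm P * norm x" using assms by (simp add: corner_P_unit)
  also have "\<dots> \<le> 1 * norm x" by (intro mult_right_mono norm_P_le_1) simp
  finally show ?thesis by simp
qed

text \<open>The orbit of an element of negative degree grows exponentially in the upper half plane.\<close>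

lemma negative_degree:
  assumes x: "x \<in> corner P" and y: "y \<in> corner P"
    and deg: "\<And>t. \<sigma> t x = phase (k * t) *\<^sub>C x" and k: "k < 0"
  shows "\<psi> (y * x) = 0"
proof (rule ccontr)
  assume ne: "\<psi> (y * x) \<noteq> 0"
  define F where "F z = ephase (of_real k * z) *\<^sub>C x" for z
  have "entire_orbit (corner P) \<sigma> x F"
    unfolding entire_orbit_def
  proof (intro conjI allI)
    show "F (of_real t) = \<sigma> t x" for t by (simp add: F_def deg phase_eq_ephase)
    show "F z \<in> corner P" for z by (simp add: F_def x corner_P_closed)
    fix z
    define e where "e = ephase (of_real k * z) * (2 * of_real pi * \<i> * of_real k)"
    have "((\<lambda>z. ephase (of_real k * z)) has_field_derivative e) (at z)"
      unfolding e_def ephase_def by (auto intro!: derivative_eq_intros)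
    then have "((\<lambda>z. ephase (of_real k * z)) has_derivative (\<lambda>h. e * h)) (at z)"
      by (simp add: has_field_derivative_def)
    from bounded_linear.has_derivative[OF bounded_linear_scaleC_left this]
    have "(F has_derivative (\<lambda>h. h *\<^sub>C (e *\<^sub>C x))) (at z)"
      by (simp add: F_def[abs_def] scaleC_scaleC mult.commute)
    then show "\<exists>D. (F has_derivative (\<lambda>h. h *\<^sub>C D)) (at z)" by blast
  qed
  note bound = ground_bound[OF x y this]
  have "exp (2 * pi * (- k) * s) * cmod (\<psi> (y * x)) \<le> norm x * norm y" if "s > 0" for s
    using bound[of "\<i> * of_real s"] that x y corner_P_closed(3)
    by (simp add: F_def mult_scaleC_right \<psi>_scaleC norm_mult norm_ephase mult_ac)
  \<comment> \<open>Exponential growth is weakened to linear growth in \<open>s\<close>, which still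
    exceeds every constant.\<close>
  then have b: "(2 * pi * (- k) * s) * cmod (\<psi> (y * x)) \<le> norm x * norm y" if "s > 0" for s
    using that mult_right_mono[OF less_imp_le[OF exp_gt_self] norm_ge_zero, of "2 * pi * (- k) * s" "\<psi> (y * x)"]
    by (meson order_trans)
  define c where "c = 2 * pi * (- k) * cmod (\<psi> (y * x))"
  have c: "c > 0" using k ne by (simp add: c_def mult_less_0_iff)
  define s where "s = (norm x * norm y + 1) / c"
  have s: "s > 0" "c * s = norm x * norm y + 1" using c by (simp_all add: s_def add_nonneg_pos)
  from b[OF s(1)] have "c * s \<le> norm x * norm y" by (simp add: c_def mult_ac)
  then show False using s(2) by simp
qed

lemma \<psi>_word_long:
  assumes \<mu>: "P * W \<mu> = W \<mu>" and \<nu>: "P * W \<nu> = W \<nu>" and l: "length \<nu> \<ge> 2"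
  shows "\<psi> (W \<mu> * star (W \<nu>)) = 0"
proof -
  let ?V = "W [N]"
  have V: "P * ?V = ?V" "star ?V * ?V = 1" by (simp_all add: word_prod_Cons P_S isometry)
  have st: "star (W \<nu>) * P = star (W \<nu>)" "star ?V * P = star ?V"
    using arg_cong[OF \<nu>, of star] arg_cong[OF V(1), of star] by (simp_all add: star_mult P_selfadjoint)
  have "\<psi> ((W \<mu> * star ?V) * (?V * star (W \<nu>))) = 0"
  proof (rule negative_degree)
    show "?V * star (W \<nu>) \<in> corner P"
      by (rule corner_P_intro) (metis V(1) st(1) mult.assoc)+
    show "W \<mu> * star ?V \<in> corner P"
      by (rule corner_P_intro) (metis \<mu> st(2) mult.assoc)+
    show "\<sigma> t (?V * star (W \<nu>)) = phase ((real (length [N]) - real (length \<nu>)) * t) *\<^sub>C (?V * star (W \<nu>))" for t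
      by (rule gauge_word_pair)
  qed (use l in simp)
  moreover have "(W \<mu> * star ?V) * (?V * star (W \<nu>)) = W \<mu> * star (W \<nu>)"
    by (metis V(2) mult.assoc mult_1_left)
  ultimately show ?thesis by simp
qed

lemma \<psi>_compressed_word_degree:
  assumes "length \<mu> < length \<nu>"
  shows "\<psi> (P * (W \<mu> * star (W \<nu>)) * P) = 0"
proof -
  have "\<psi> (P * (P * (W \<mu> * star (W \<nu>)) * P)) = 0"
  proof (rule negative_degree)
    show "\<sigma> t (P * (W \<mu> * star (W \<nu>)) * P)
        = phase ((real (length \<mu>) - real (length \<nu>)) * t) *\<^sub>C (P * (W \<mu> * star (W \<nu>)) * P)" for t
      by (simp only: mult[of t "P * _"] mult[of t P] gauge_P gauge_word_pair mult_scaleC_left mult_scaleC_right)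
  qed (use assms corner_P_closed in auto)
  then show ?thesis by (simp add: corner_P_unit corner_P_closed)
qed

text \<open>For words of length one, \<open>S\<^sub>i S\<^sub>j\<^sup>* = (S\<^sub>i P) (P S\<^sub>j\<^sup>*) + (\<Sum>k<N. S\<^sub>i S\<^sub>k S\<^sub>k\<^sup>* S\<^sub>j\<^sup>*)\<close>.\<close>

lemma \<psi>_generator_pair:
  assumes "i \<ge> N" "j \<ge> N"
  shows "\<psi> (S i * star (S j)) = 0"
proof -
  have Pj: "star (S j) * P = star (S j)"
    using arg_cong[OF P_S[of j], of star] assms by (simp add: star_mult P_selfadjoint)
  have Pi: "P * S i = S i" using assms by (simp add: P_S)
  let ?f = "\<lambda>k. W [i, k] * star (W [j, k])"
  have in1: "P * star (S j) \<in> corner P"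
    by (rule corner_P_intro) (metis Pj P_idem mult.assoc)+
  have in2: "S i * P \<in> corner P"
    by (rule corner_P_intro) (metis Pi P_idem mult.assoc)+
  have deg: "\<sigma> t (P * star (S j)) = phase (-1 * t) *\<^sub>C (P * star (S j))" for t
    by (simp add: mult gauge_P star gauge star_scaleC cnj_phase mult_scaleC_right)
  have 1: "\<psi> ((S i * P) * (P * star (S j))) = 0"
    by (rule negative_degree[OF in1 in2 deg]) simp
  have PW: "P * W [l, k] = W [l, k]" if "l \<ge> N" for l k using that by (simp add: P_word)
  have in3: "?f k \<in> corner P" for k
    using PW[OF assms(1), of k] arg_cong[OF PW[OF assms(2), of k], of star]
    by (intro corner_P_intro) (simp_all only: star_mult P_selfadjoint mult.assoc flip: mult.assoc[of P])
  have 2: "\<psi> (?f k) = 0" for k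
    by (rule \<psi>_word_long) (use assms PW in auto)
  have "S i * star (S j) = S i * (P + (\<Sum>k<N. S k * star (S k))) * star (S j)"
    by (simp add: P_proj_def)
  also have "\<dots> = (S i * P) * (P * star (S j)) + (\<Sum>k<N. ?f k)"
  proof -
    have "S i * P * star (S j) = (S i * P) * (P * star (S j))" by (metis P_idem mult.assoc)
    then show ?thesis
      by (simp add: distrib_left distrib_right sum_distrib_left sum_distrib_right word_prod_Cons star_mult mult.assoc)
  qed
  finally show ?thesis
    using \<psi>_sum[of "{..<N}" ?f] in3 1 2 \<psi>_add[OF corner_P_closed(3)[OF in2 in1], of "sum ?f {..<N}"] by simp
qed

text \<open>Negative degree is covered directly and positive degree by taking adjoints. In degree 0
  the projection \<open>P\<close> kills words whose first letter is below \<open>N\<close>; the rest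
  split into single letters and words of length at least 2.\<close>

lemma \<psi>_compressed_word:
  assumes ne: "\<not> (\<mu> = [] \<and> \<nu> = [])"
  shows "\<psi> (P * (W \<mu> * star (W \<nu>)) * P) = 0"
proof (rule linorder_cases[of "length \<mu>" "length \<nu>"])
  assume "length \<mu> < length \<nu>"
  then show ?thesis by (rule \<psi>_compressed_word_degree)
next
  assume "length \<nu> < length \<mu>"
  then have "\<psi> (P * (W \<nu> * star (W \<mu>)) * P) = 0" by (rule \<psi>_compressed_word_degree)
  moreover have "star (P * (W \<nu> * star (W \<mu>)) * P) = P * (W \<mu> * star (W \<nu>)) * P"
    by (simp add: star_mult star_star P_selfadjoint mult.assoc)
  ultimately show ?thesis
    using \<psi>_star[OF corner_P_closed(6)[of "W \<nu> * star (W \<mu>)"]] by simp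
next
  assume len: "length \<mu> = length \<nu>"
  with ne have nn: "\<mu> \<noteq> []" "\<nu> \<noteq> []" by auto
  have eq: "P * (W \<mu> * star (W \<nu>)) * P = (P * W \<mu>) * star (P * W \<nu>)"
    by (simp add: star_mult P_selfadjoint mult.assoc)
  show ?thesis
  proof (cases "hd \<mu> < N \<or> hd \<nu> < N")
    case True
    then have "(P * W \<mu>) * star (P * W \<nu>) = 0" using nn by (auto simp: P_word star_zero)
    then show ?thesis unfolding eq by (simp add: \<psi>_0)
  next
    case False
    then have PW: "P * W \<mu> = W \<mu>" "P * W \<nu> = W \<nu>" using nn by (auto simp: P_word)
    show ?thesis
    proof (cases "length \<nu> \<ge> 2")
      case True
      then show ?thesis unfolding eq PW using \<psi>_word_long[OF PW] by simp
    next
      case short: False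
      with len nn obtain i j where "\<mu> = [i]" "\<nu> = [j]"
        by (cases \<mu>; cases \<nu>; cases "tl \<mu>"; cases "tl \<nu>") auto
      then show ?thesis unfolding eq PW using False \<psi>_generator_pair[of i j] by (simp add: word_prod_Cons)
    qed
  qed
qed

end

text \<open>Both functionals take the value 1 at \<open>P\<close> and vanish on every other
  compressed word. Compressed words span a dense subspace of the corner, and both functionals are
  norm bounded there.\<close>

lemma gauge_ground_state_unique:
  assumes "gauge_ground_state N A S \<sigma> \<psi>" "gauge_ground_state N A S \<sigma> \<psi>'"
    and X: "X \<in> corner (P_proj N S)"
  shows "\<psi> X = \<psi>' X"
proof -
  interpret a: gauge_ground_state N A S \<sigma> \<psi> by fact
  interpret b: gauge_ground_state N A S \<sigma> \<psi>' by fact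
  let ?P = "P_proj N S"
  have eq: "\<psi> (?P * x * ?P) = \<psi>' (?P * x * ?P)" if "x \<in> word_span S" for x
    using that
  proof (induction rule: word_span.induct)
    case (word \<mu> \<nu>)
    show ?case
      using a.\<psi>_compressed_word[of \<mu> \<nu>] b.\<psi>_compressed_word[of \<mu> \<nu>] a.\<psi>_P b.\<psi>_P
      by (cases "\<mu> = [] \<and> \<nu> = []") (auto simp: a.P_idem)
  next
    case (add x y)
    then show ?case
      by (simp add: distrib_left distrib_right a.\<psi>_add b.\<psi>_add a.corner_P_closed)
  next
    case (scale x c)
    then show ?case
      by (simp add: mult_scaleC_left mult_scaleC_right a.\<psi>_scaleC b.\<psi>_scaleC a.corner_P_closed)
  qed
  obtain f where f: "\<And>n. f n \<in> word_span S" "f \<longlonglongrightarrow> X" using a.word_span_approx[of X] by blast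
  define g where "g n = ?P * f n * ?P" for n
  have g: "g n \<in> corner ?P" for n by (simp add: g_def a.corner_P_closed)
  have "g \<longlonglongrightarrow> ?P * X * ?P" unfolding g_def[abs_def] by (intro tendsto_intros f)
  then have "g \<longlonglongrightarrow> X" using X by (simp add: a.corner_P_unit)
  then have lim: "(\<lambda>n. norm (g n - X)) \<longlonglongrightarrow> 0" by (simp add: LIM_zero_iff tendsto_norm_zero_iff)
  have "(\<lambda>n. \<psi> (g n) - \<psi> X) \<longlonglongrightarrow> 0"
    by (rule Lim_null_comparison[OF _ lim])
       (use a.\<psi>_bound[OF a.corner_diff[OF g X]] a.\<psi>_diff[OF g X] in simp)
  moreover have "(\<lambda>n. \<psi> (g n) - \<psi>' X) \<longlonglongrightarrow> 0"
    by (rule Lim_null_comparison[OF _ lim])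
       (use b.\<psi>_bound[OF a.corner_diff[OF g X]] b.\<psi>_diff[OF g X] eq f(1) in \<open>simp add: g_def\<close>)
  ultimately have "(\<lambda>n. \<psi>' X - \<psi> X) \<longlonglongrightarrow> 0 - 0" by (drule_tac tendsto_diff) (assumption, simp)
  then show ?thesis by (simp add: LIMSEQ_const_iff)
qed

theorem proposition6p4:
  fixes N :: nat and A :: "nat mat"
    and S :: "nat \<Rightarrow> 'a::cstar_algebra"
    and \<alpha> \<beta> \<gamma> :: "real \<Rightarrow> 'a \<Rightarrow> 'a"
    and \<phi> :: "'a \<Rightarrow> complex"
  assumes "A \<in> carrier_mat N N"
    and "\<forall>i<N. \<forall>j<N. A $$ (i, j) \<in> {0, 1}"
    and "irreducible_matrix N A"
    and "\<not> permutation_matrix N A"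
    and "is_OA_inf N A S"
    and "one_parameter_action UNIV 1 \<alpha>"
    and "\<forall>t j. \<alpha> t (S j) = (if j < N then phase t *\<^sub>C S j else S j)"
    and "one_parameter_action UNIV 1 \<beta>"
    and "\<forall>t j. \<beta> t (S j) = (if j < N then S j else phase t *\<^sub>C S j)"
    and "one_parameter_action UNIV 1 \<gamma>"
    and "\<forall>t j. \<gamma> t (S j) = phase t *\<^sub>C S j"
    and "state UNIV 1 \<phi>"
    and "\<forall>\<mu> \<nu>. \<not> (\<mu> = [] \<and> \<nu> = []) \<longrightarrow> \<phi> (word_prod S \<mu> * star (word_prod S \<nu>)) = 0"
  shows "(ground_state (corner (P_proj N S)) (P_proj N S) \<alpha> \<phi> \<and> ground_state (corner (P_proj N S)) (P_proj N S) \<beta> \<phi> \<and>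
          ground_state (corner (P_proj N S)) (P_proj N S) \<gamma> \<phi>)
    \<and> (\<forall>\<psi>. ground_state (corner (P_proj N S)) (P_proj N S) \<gamma> \<psi> \<longrightarrow> (\<forall>X\<in>corner (P_proj N S). \<psi> X = \<phi> X))
    \<and> spectral_gap (corner (P_proj N S)) (P_proj N S) \<gamma> \<phi> 1"
proof -
  interpret OA_inf_algebra N A S
    using assms(5) unfolding is_OA_inf_def OA_inf_relations_UNIV by unfold_locales auto
  interpret state_on \<phi> by unfold_locales fact
  interpret \<alpha>: vacuum_state N A S \<phi> \<alpha> "\<lambda>j. if j < N then 1 else 0"
    by unfold_locales (use assms in \<open>auto simp: scaleC_one\<close>)
  interpret \<beta>: vacuum_state N A S \<phi> \<beta> "\<lambda>j. if j < N then 0 else 1"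
    by unfold_locales (use assms in \<open>auto simp: scaleC_one\<close>)
  interpret \<gamma>: vacuum_state N A S \<phi> \<gamma> "\<lambda>j. 1"
    by unfold_locales (use assms in auto)
  interpret gauge_action N A S \<gamma>
    by unfold_locales (use assms in auto)
  have gap: "spectral_gap (corner P) P \<gamma> \<phi> 1"
    by (rule spectral_gap_mono[OF \<gamma>.corner_spectral_gap]) (use pi_ge_two Re_pos in auto)
  have "\<psi> X = \<phi> X" if "ground_state (corner P) P \<gamma> \<psi>" "X \<in> corner P" for \<psi> X
    by (rule gauge_ground_state_unique[of N A S \<gamma>])
       (use that \<gamma>.corner_ground_state in \<open>auto intro!: gauge_ground_state.intro gauge_ground_state_axioms.intro gauge_action_axioms\<close>)
  with gap show ?thesis
    using \<alpha>.corner_ground_state \<beta>.corner_ground_state \<gamma>.corner_ground_state by blast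
qed

end
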